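(* Let $k,N\ge1$ be integers, let $c_1,\dots,c_{N+1},b_1,\dots,b_{N+1}$ be positive real numbers and $t>0$. Let $\boldsymbol\lambda^{(n)}=(\boldsymbol\lambda^{(n,1)},\dots,\boldsymbol\lambda^{(n,k)})$ and $\boldsymbol\mu^{(n)}=(\boldsymbol\mu^{(n,1)},\dots,\boldsymbol\mu^{(n,k)})$, $n=1,\dots,N$, be sampled from the LLT process $$\frac1Z\prod_{n=1}^{N}\mathcal L_{\boldsymbol\lambda^{(n)}/\boldsymbol\mu^{(n)}}(c_n;t)\;\widehat{\mathcal L}_{\boldsymbol\lambda^{(n)}/\boldsymbol\mu^{(n+1)}}(b_{N-n+1};t),\qquad \boldsymbol\mu^{(1)}=\boldsymbol\mu^{(N+1)}=\boldsymbol 0,$$ and set $\boldsymbol\lambda^{(N+1)}=\boldsymbol\mu^{(N+1)}=\boldsymbol 0$ deterministically; let $\boldsymbol x^{(n,l)}_i$ and $\boldsymbol y^{(n,l)}_i$ ($n=1,\dots,N+1$) be the corresponding particle positions. Let $\tilde{\boldsymbol\lambda}^{(n)},\tilde{\boldsymbol\mu}^{(n)}$ be the sequence after the update, with particle positions $\tilde{\boldsymbol x}^{(n,l)}_i,\tilde{\boldsymbol y}^{(n,l)}_i$. Then the LLT parallel update is equivalent to the following dynamics on particles; that is, given the initial configuration, the updated configuration has the same conditional distribution under both. For each $n=1,\dots,N+1$: 1. If $n\ge2$, set $\tilde{\boldsymbol y}^{(n)}=\boldsymbol x^{(n-1)}$ deterministically. 2. Given $\boldsymbol x^{(n)}$ and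 $\tilde{\boldsymbol y}^{(n)}$, sample $\tilde{\boldsymbol x}^{(n)}$ as follows, for each $l=1,\dots,k$ and $i=1,\dots,n$: - if $\boldsymbol x^{(n,l)}_i=\tilde{\boldsymbol y}^{(n,l)}_i-1$, then $\tilde{\boldsymbol x}^{(n,l)}_i=\boldsymbol x^{(n,l)}_i+1$ with probability $1$; - if $\boldsymbol x^{(n,l)}_i=\tilde{\boldsymbol y}^{(n,l)}_{i-1}-1$ (where $i\ge2$), then $\tilde{\boldsymbol x}^{(n,l)}_i=\boldsymbol x^{(n,l)}_i$ with probability $1$; - otherwise, $\tilde{\boldsymbol x}^{(n,l)}_i=\boldsymbol x^{(n,l)}_i+1$ with probability $$\frac{c_n\,b_{N-n+2}\,t^{\#_i(n,l)}}{1+c_n\,b_{N-n+2}\,t^{\#_i(n,l)}},$$ and $\tilde{\boldsymbol x}^{(n,l)}_i=\boldsymbol x^{(n,l)}_i$ otherwise, where $$\#_i(n,l)=\bigl|\{m>l:\exists j,\ \tilde{\boldsymbol y}^{(n,m)}_j\le\boldsymbol x^{(n,l)}_i\le\boldsymbol x^{(n,m)}_j\}\bigr|+\bigl|\{m<l:\exists j,\ \tilde{\boldsymbol y}^{(n,m)}_j\le\boldsymbol x^{(n,l)}_i+1\le\boldsymbol x^{(n,m)}_j\}\bigr|.$$ Here $j$ ranges over $1,\dots,n$, with the convention $\tilde{\boldsymbol y}^{(n,m)}_n=-n+\tfrac12$. The transitions are independent for all $1\le i\le n\le N+1$, $1\le l\le k$.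
   Context: Partitions are padded with infinitely many zero parts. Bold letters denote $k$-tuples of partitions $\boldsymbol\lambda=(\boldsymbol\lambda^{(1)},\dots,\boldsymbol\lambda^{(k)})$, with $\boldsymbol\lambda^{(a)}_i$ the $i$-th part of the $a$-th partition (the color-$a$ component); in a sequence of $k$-tuples, $\boldsymbol\lambda^{(n)}$ is the $n$-th $k$-tuple and $\boldsymbol\lambda^{(n,a)}$ its color-$a$ component. $\boldsymbol 0$ is the $k$-tuple of empty partitions, and $|\boldsymbol\lambda|$ is the sum of the sizes of the components. Write $\boldsymbol\lambda\succeq\boldsymbol\mu$ (interlacing) if for every color $\boldsymbol\lambda^{(a)}_1\ge\boldsymbol\mu^{(a)}_1\ge\boldsymbol\lambda^{(a)}_2\ge\boldsymbol\mu^{(a)}_2\ge\cdots$, and $\boldsymbol\lambda\succeq'\boldsymbol\mu$ (co-interlacing) if for every color the conjugate partitions interlace, i.e. $\boldsymbol\lambda^{(a)}_i-\boldsymbol\mu^{(a)}_i\in\{0,1\}$ for all $i$. Particle positions: at level $n$ each color $l$ has $n$ particles $\boldsymbol x^{(n,l)}_i=\boldsymbol\lambda^{(n,l)}_i-i+\tfrac12$ ($1\le i\le n$) and $n-1$ particles $\boldsymbol y^{(n,l)}_i=\boldsymbol\mu^{(n,l)}_i-i+\tfrac12$ ($1\le i\le n-1$); $\boldsymbol x^{(n)}=(\boldsymbol x^{(n,1)},\dots,\boldsymbol x^{(n,k)})$ and similarly for $\boldsymbol y^{(n)}$, and the same formulas with tildes after the update. (For sequences in the support of the process, $\boldsymbol\lambda^{(n,l)}$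 has at most $n$ and $\boldsymbol\mu^{(n,l)}$ at most $n-1$ nonzero parts.) Coinversion LLT polynomials: for $\boldsymbol\mu\subseteq\boldsymbol\lambda$, $$\mathcal L_{\boldsymbol\lambda/\boldsymbol\mu}(x_1,\dots,x_n;t)=\sum_{\boldsymbol\sigma}x^{\boldsymbol\sigma}t^{\mathrm{coinv}(\boldsymbol\sigma)},$$ summed over $k$-tuples $\boldsymbol\sigma=(\sigma^{(1)},\dots,\sigma^{(k)})$, $\sigma^{(a)}$ a semistandard filling of $\boldsymbol\lambda^{(a)}/\boldsymbol\mu^{(a)}$ with entries in $\{1,\dots,n\}$ (weakly increasing along rows, strictly increasing with the row index along columns); it is $0$ if $\boldsymbol\mu\not\subseteq\boldsymbol\lambda$. The statistic $\mathrm{coinv}(\boldsymbol\sigma)$ counts coinversion triples: an entry $y$ at a cell of $\boldsymbol\lambda^{(a)}/\boldsymbol\mu^{(a)}$ together with two horizontally adjacent positions in some row $j\geq 1$ of color $b>a$, with values $x$ (left) and $z$ (right), such that the position of $z$ has the same content (row minus column) as the cell of $y$, and $x\le y\le z$. Positions in row $j$ of color $b$ that are not cells of $\boldsymbol\lambda^{(b)}/\boldsymbol\mu^{(b)}$ are given value $0$ if their column is $\le\boldsymbol\mu^{(b)}_j$ (including column $0$ and negative columns) and $\infty$ if their column is $>\boldsymbol\lambda^{(b)}_j$. We write $\mathcal L_{\boldsymbol\lambda}=\mathcal L_{\boldsymbol\lambda/\boldsymbol 0}$; with no variables $\mathcal L_{\boldsymbol\lambda}$ equals $1$ if $\boldsymbol\lambda=\boldsymbol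 0$ and $0$ otherwise. In one variable, $\mathcal L_{\boldsymbol\lambda/\boldsymbol\mu}(x;t)$ is a monomial when $\boldsymbol\lambda\succeq\boldsymbol\mu$ and $0$ otherwise. Dual one-variable weight: $\widehat{\mathcal L}_{\boldsymbol\lambda/\boldsymbol\mu}(y;t)=y^{|\boldsymbol\lambda|-|\boldsymbol\mu|}\,t^{e(\boldsymbol\lambda,\boldsymbol\mu)}$ if $\boldsymbol\lambda\succeq'\boldsymbol\mu$ and $0$ otherwise, where $e(\boldsymbol\lambda,\boldsymbol\mu)$ is the number of quadruples $(a,b,i,j)$ with colors $a<b$ and rows $i,j\ge1$ such that $$\boldsymbol\lambda^{(b)}_j-j=\boldsymbol\mu^{(b)}_j-j+1=\boldsymbol\mu^{(a)}_i-i=\boldsymbol\lambda^{(a)}_i-i .$$ (In the paper this is written $t^{\tilde d(\boldsymbol\lambda,\boldsymbol\mu)}\tilde{\mathcal L}_{\boldsymbol\lambda/\boldsymbol\mu}(y;t)$.) Transition kernels: write $c_{[1,n]}=(c_1,\dots,c_n)$ and define $$p^{\uparrow}_{\boldsymbol\lambda\to\boldsymbol\mu}(c_{[1,n]}|b)=\frac1{\prod_{i=1}^n\prod_{l=0}^{k-1}(1+c_ib\,t^l)}\,\frac{\mathcal L_{\boldsymbol\mu}(c_{[1,n]};t)}{\mathcal L_{\boldsymbol\lambda}(c_{[1,n]};t)}\,\widehat{\mathcal L}_{\boldsymbol\mu/\boldsymbol\lambda}(b;t),$$ $$p^{\downarrow}_{\boldsymbol\lambda\to\boldsymbol\mu}(c_{[1,n-1]}|c_n)=\frac{\mathcal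 L_{\boldsymbol\mu}(c_{[1,n-1]};t)}{\mathcal L_{\boldsymbol\lambda}(c_{[1,n]};t)}\,\mathcal L_{\boldsymbol\lambda/\boldsymbol\mu}(c_n;t).$$ LLT parallel update: given $\boldsymbol 0\preceq\boldsymbol\lambda^{(1)}\succeq'\boldsymbol\mu^{(2)}\preceq\boldsymbol\lambda^{(2)}\succeq'\cdots\succeq'\boldsymbol\mu^{(N+1)}\preceq\boldsymbol\lambda^{(N+1)}\succeq'\boldsymbol 0$: (1) for $n=2,\dots,N+1$ set $\tilde{\boldsymbol\mu}^{(n)}=\boldsymbol\lambda^{(n-1)}$, and $\tilde{\boldsymbol\mu}^{(1)}=\boldsymbol 0$; (2) for $n=1,\dots,N+1$, independently, sample $\tilde{\boldsymbol\lambda}^{(n)}$ with probability $\tilde P_n(\tilde{\boldsymbol\lambda}^{(n)}|\boldsymbol\lambda^{(n)},\tilde{\boldsymbol\mu}^{(n)})$, where $$\tilde P_n(\tilde{\boldsymbol\lambda}|\boldsymbol\lambda,\tilde{\boldsymbol\mu})=\frac{p^{\uparrow}_{\boldsymbol\lambda\to\tilde{\boldsymbol\lambda}}(c_{[1,n]}|b_{N-n+2})\,p^{\downarrow}_{\tilde{\boldsymbol\lambda}\to\tilde{\boldsymbol\mu}}(c_{[1,n-1]}|c_n)}{\sum_{\boldsymbol\kappa}p^{\uparrow}_{\boldsymbol\lambda\to\boldsymbol\kappa}(c_{[1,n]}|b_{N-n+2})\,p^{\downarrow}_{\boldsymbol\kappa\to\tilde{\boldsymbol\mu}}(c_{[1,n-1]}|c_n)}.$$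 *)

theory Defs
  imports "HOL-Probability.Probability" "HOL-Probability.Product_PMF"
begin

section \<open>Tuples of partitions\<close>

text \<open>
  A partition is the sequence of its parts, indexed from 1 and padded with zeros; the unused
  index 0 is pinned to 0. A \<open>k\<close>-tuple is indexed by the colours \<open>1,\<dots>,k\<close>, and is empty at every
  other index. Thus equality of functions is equality of (tuples of) partitions.
\<close>

definition is_partition :: "(nat \<Rightarrow> nat) \<Rightarrow> bool" where
  "is_partition p \<longleftrightarrow> p 0 = 0 \<and> (\<forall>i\<ge>1. p (Suc i) \<le> p i) \<and> finite {i. p i \<noteq> 0}"

type_synonym ptuple = "nat \<Rightarrow> nat \<Rightarrow> nat"

definition ptuples :: "nat \<Rightarrow> ptuple set" where
  "ptuples k = {L. (\<forall>a\<in>{1..k}. is_partition (L a)) \<and> (\<forall>a. a \<notin> {1..k} \<longrightarrow> L a = (\<lambda>_. 0))}"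

definition empty_ptuple :: ptuple where
  "empty_ptuple = (\<lambda>_ _. 0)"

definition ptuple_size :: "nat \<Rightarrow> ptuple \<Rightarrow> nat" where
  "ptuple_size k L = (\<Sum>a=1..k. \<Sum>i | L a i \<noteq> 0. L a i)"

definition contained :: "nat \<Rightarrow> ptuple \<Rightarrow> ptuple \<Rightarrow> bool" where
  "contained k M L \<longleftrightarrow> (\<forall>a\<in>{1..k}. \<forall>i\<ge>1. M a i \<le> L a i)"

definition cointerlace :: "nat \<Rightarrow> ptuple \<Rightarrow> ptuple \<Rightarrow> bool" where
  "cointerlace k L M \<longleftrightarrow> (\<forall>a\<in>{1..k}. \<forall>i\<ge>1. int (L a i) - int (M a i) \<in> {0, 1})"


section \<open>Coinversion LLT polynomials\<close>

text \<open>
  In a skew shape, \<open>L\<close> is the outer and \<open>M\<close> the inner tuple. Cells are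
  triples (colour, row, column).
\<close>

definition skew_cells :: "nat \<Rightarrow> ptuple \<Rightarrow> ptuple \<Rightarrow> (nat \<times> nat \<times> nat) set" where
  "skew_cells k L M = {(a, i, j). a \<in> {1..k} \<and> 1 \<le> i \<and> M a i < j \<and> j \<le> L a i}"

definition ssfillings :: "nat \<Rightarrow> ptuple \<Rightarrow> ptuple \<Rightarrow> nat \<Rightarrow> (nat \<times> nat \<times> nat \<Rightarrow> nat) set" where
  "ssfillings k L M n = {\<sigma> \<in> skew_cells k L M \<rightarrow>\<^sub>E {1..n}.
     (\<forall>a i j j'. (a, i, j) \<in> skew_cells k L M \<and> (a, i, j') \<in> skew_cells k L M \<and> j < j'
        \<longrightarrow> \<sigma> (a, i, j) \<le> \<sigma> (a, i, j')) \<and>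
     (\<forall>a i i' j. (a, i, j) \<in> skew_cells k L M \<and> (a, i', j) \<in> skew_cells k L M \<and> i < i'
        \<longrightarrow> \<sigma> (a, i, j) < \<sigma> (a, i', j))}"

definition entry ::
  "ptuple \<Rightarrow> ptuple \<Rightarrow> (nat \<times> nat \<times> nat \<Rightarrow> nat) \<Rightarrow> nat \<Rightarrow> nat \<Rightarrow> int \<Rightarrow> enat" where
  "entry L M \<sigma> b j r =
     (if r \<le> int (M b j) then 0 else if r > int (L b j) then \<infinity> else enat (\<sigma> (b, j, nat r)))"

text \<open>
  A triple is determined by the cell \<open>(a, i, r)\<close> of \<open>y\<close> and the row \<open>(b, j)\<close> of \<open>x\<close> and \<open>z\<close>: equality
  of contents puts \<open>z\<close> in column \<open>r + j - i\<close>. Only finitely many rows \<open>j\<close> contribute to each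
  cell, since \<open>x\<close> is infinite in all low enough empty rows.
\<close>

definition coinv :: "nat \<Rightarrow> ptuple \<Rightarrow> ptuple \<Rightarrow> (nat \<times> nat \<times> nat \<Rightarrow> nat) \<Rightarrow> nat" where
  "coinv k L M \<sigma> = card {((a, i, r), (b, j)).
     (a, i, r) \<in> skew_cells k L M \<and> a < b \<and> b \<le> k \<and> 1 \<le> j \<and>
     entry L M \<sigma> b j (int r + int j - int i - 1) \<le> enat (\<sigma> (a, i, r)) \<and>
     enat (\<sigma> (a, i, r)) \<le> entry L M \<sigma> b j (int r + int j - int i)}"

text \<open>The variables are \<open>x 1, \<dots>, x n\<close>.\<close>

definition LLT :: "nat \<Rightarrow> ptuple \<Rightarrow> ptuple \<Rightarrow> nat \<Rightarrow> (nat \<Rightarrow> real) \<Rightarrow> real \<Rightarrow> real" where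
  "LLT k L M n x t =
     (if contained k M L
      then \<Sum>\<sigma>\<in>ssfillings k L M n. (\<Prod>u\<in>skew_cells k L M. x (\<sigma> u)) * t ^ coinv k L M \<sigma>
      else 0)"

definition dual_exponent :: "nat \<Rightarrow> ptuple \<Rightarrow> ptuple \<Rightarrow> nat" where
  "dual_exponent k L M = card {(a, b, i, j).
     a \<in> {1..k} \<and> b \<in> {1..k} \<and> a < b \<and> 1 \<le> i \<and> 1 \<le> j \<and>
     int (L b j) - int j = int (M b j) - int j + 1 \<and>
     int (M b j) - int j + 1 = int (M a i) - int i \<and>
     int (M a i) - int i = int (L a i) - int i}"

definition dual_LLT :: "nat \<Rightarrow> ptuple \<Rightarrow> ptuple \<Rightarrow> real \<Rightarrow> real \<Rightarrow> real" where
  "dual_LLT k L M y t =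
     (if cointerlace k L M
      then y ^ (ptuple_size k L - ptuple_size k M) * t ^ dual_exponent k L M
      else 0)"


section \<open>The LLT process and the parallel update\<close>

text \<open>
  The probability distribution on \<open>A\<close> proportional to the weight \<open>w\<close>. As with \<^const>\<open>embed_pmf\<close>, this is
  meaningful only if \<open>w\<close> is nonnegative with finite nonzero total mass; see the lemma below.
\<close>

definition normalized_pmf :: "'a set \<Rightarrow> ('a \<Rightarrow> real) \<Rightarrow> 'a pmf" where
  "normalized_pmf A w = embed_pmf (\<lambda>x. if x \<in> A then w x / (\<Sum>\<^sub>\<infinity>y\<in>A. w y) else 0)"

lemma pmf_normalized_pmf:
  fixes w :: "'a \<Rightarrow> real"
  assumes nonneg: "\<And>x. x \<in> A \<Longrightarrow> 0 \<le> w x"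
    and fin: "finite {x \<in> A. w x \<noteq> 0}" and ne: "{x \<in> A. w x \<noteq> 0} \<noteq> {}"
  shows "pmf (normalized_pmf A w) x = (if x \<in> A then w x / (\<Sum>\<^sub>\<infinity>y\<in>A. w y) else 0)"
proof -
  let ?S = "{x \<in> A. w x \<noteq> 0}"
  let ?Z = "\<Sum>\<^sub>\<infinity>y\<in>A. w y"
  let ?f = "\<lambda>x. if x \<in> A then w x / ?Z else 0"
  have "?Z = (\<Sum>\<^sub>\<infinity>y\<in>?S. w y)"
    by (rule infsum_cong_neutral) auto
  also have "\<dots> = sum w ?S"
    using fin by simp
  finally have Z: "?Z = sum w ?S" .
  have "0 < sum w ?S"
    using nonneg fin ne by (intro sum_pos) (auto simp: order_less_le)
  with Z have Zpos: "0 < ?Z" by simp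
  have f0: "0 \<le> ?f x" for x
    using nonneg Zpos by auto
  have "(\<integral>\<^sup>+x. ennreal (?f x) \<partial>count_space UNIV) = (\<Sum>x\<in>?S. ennreal (?f x))"
    by (rule nn_integral_count_space'[OF fin]) auto
  also have "\<dots> = ennreal (\<Sum>x\<in>?S. ?f x)"
    by (intro sum_ennreal f0)
  also have "(\<Sum>x\<in>?S. ?f x) = (\<Sum>x\<in>?S. w x) / ?Z"
    by (simp add: sum_divide_distrib)
  also have "\<dots> = 1"
    using Z Zpos by simp
  finally have "(\<integral>\<^sup>+x. ennreal (?f x) \<partial>count_space UNIV) = 1" by simp
  then show ?thesis
    unfolding normalized_pmf_def using f0 by (subst pmf_embed_pmf) auto
qed

text \<open>
  The state is the pair of the sequence of the \<open>\<lambda>\<close> and the sequence of the \<open>\<mu>\<close>, indexed by the level \<open>n\<close>. In the LLT process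
  the levels are \<open>1,\<dots>,N\<close>; both sequences are empty at all other indices, which includes the
  boundary condition at \<open>N + 1\<close> and the deterministic values there used by the update.
\<close>

type_synonym sequences = "(nat \<Rightarrow> ptuple) \<times> (nat \<Rightarrow> ptuple)"

definition llt_states :: "nat \<Rightarrow> nat \<Rightarrow> sequences set" where
  "llt_states k N = {(Lam, Mu).
     (\<forall>n\<in>{1..N}. Lam n \<in> ptuples k \<and> Mu n \<in> ptuples k) \<and>
     (\<forall>n. n \<notin> {1..N} \<longrightarrow> Lam n = empty_ptuple \<and> Mu n = empty_ptuple) \<and>
     Mu 1 = empty_ptuple}"

definition llt_weight ::
  "nat \<Rightarrow> nat \<Rightarrow> (nat \<Rightarrow> real) \<Rightarrow> (nat \<Rightarrow> real) \<Rightarrow> real \<Rightarrow> sequences \<Rightarrow> real" where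
  "llt_weight k N c b t = (\<lambda>(Lam, Mu).
     \<Prod>n=1..N. LLT k (Lam n) (Mu n) 1 (\<lambda>_. c n) t * dual_LLT k (Lam n) (Mu (n + 1)) (b (N + 1 - n)) t)"

definition llt_process ::
  "nat \<Rightarrow> nat \<Rightarrow> (nat \<Rightarrow> real) \<Rightarrow> (nat \<Rightarrow> real) \<Rightarrow> real \<Rightarrow> sequences pmf" where
  "llt_process k N c b t = normalized_pmf (llt_states k N) (llt_weight k N c b t)"

text \<open>The kernels for the variables \<open>c 1, \<dots>, c n\<close>; in \<open>p_down\<close> the variable \<open>c n\<close> is removed.\<close>

definition p_up ::
  "nat \<Rightarrow> nat \<Rightarrow> (nat \<Rightarrow> real) \<Rightarrow> real \<Rightarrow> real \<Rightarrow> ptuple \<Rightarrow> ptuple \<Rightarrow> real" where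
  "p_up k n c \<beta> t L M =
     1 / (\<Prod>i=1..n. \<Prod>l<k. 1 + c i * \<beta> * t ^ l) *
     (LLT k M empty_ptuple n c t / LLT k L empty_ptuple n c t) * dual_LLT k M L \<beta> t"

definition p_down ::
  "nat \<Rightarrow> nat \<Rightarrow> (nat \<Rightarrow> real) \<Rightarrow> real \<Rightarrow> ptuple \<Rightarrow> ptuple \<Rightarrow> real" where
  "p_down k n c t L M =
     LLT k M empty_ptuple (n - 1) c t / LLT k L empty_ptuple n c t * LLT k L M 1 (\<lambda>_. c n) t"

definition P_tilde ::
  "nat \<Rightarrow> nat \<Rightarrow> (nat \<Rightarrow> real) \<Rightarrow> real \<Rightarrow> real \<Rightarrow> ptuple \<Rightarrow> ptuple \<Rightarrow> ptuple pmf" where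
  "P_tilde k n c \<beta> t L Mt =
     normalized_pmf (ptuples k) (\<lambda>K. p_up k n c \<beta> t L K * p_down k n c t K Mt)"

text \<open>The subscript of \<open>b\<close> is written \<open>N + 2 - n\<close> because subtraction on naturals truncates.\<close>

definition llt_update ::
  "nat \<Rightarrow> nat \<Rightarrow> (nat \<Rightarrow> real) \<Rightarrow> (nat \<Rightarrow> real) \<Rightarrow> real \<Rightarrow> sequences \<Rightarrow> sequences pmf" where
  "llt_update k N c b t = (\<lambda>(Lam, Mu).
     let Mut = (\<lambda>n. if n \<in> {2..N+1} then Lam (n - 1) else empty_ptuple)
     in map_pmf (\<lambda>Lamt. (Lamt, Mut))
          (Pi_pmf {1..N+1} empty_ptuple (\<lambda>n. P_tilde k n c (b (N + 2 - n)) t (Lam n) (Mut n))))"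


section \<open>Particles\<close>

text \<open>
  Particle positions \<open>x\<close> and \<open>y\<close> are indexed by (level, colour, particle number), and are 0 off the
  index set; \<open>extended_y\<close> adds the conventional \<open>n\<close>-th \<open>y\<close>-particle of level \<open>n\<close>.
\<close>

type_synonym positions = "nat \<times> nat \<times> nat \<Rightarrow> real"

definition x_indices :: "nat \<Rightarrow> nat \<Rightarrow> (nat \<times> nat \<times> nat) set" where
  "x_indices k N = {(n, l, i). n \<in> {1..N+1} \<and> l \<in> {1..k} \<and> i \<in> {1..n}}"

definition y_indices :: "nat \<Rightarrow> nat \<Rightarrow> (nat \<times> nat \<times> nat) set" where
  "y_indices k N = {(n, l, i). n \<in> {1..N+1} \<and> l \<in> {1..k} \<and> 1 \<le> i \<and> i < n}"

definition particle_positions :: "nat \<Rightarrow> nat \<Rightarrow> sequences \<Rightarrow> positions \<times> positions" where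
  "particle_positions k N = (\<lambda>(Lam, Mu).
     ((\<lambda>(n, l, i). if (n, l, i) \<in> x_indices k N then real (Lam n l i) - real i + 1/2 else 0),
      (\<lambda>(n, l, i). if (n, l, i) \<in> y_indices k N then real (Mu n l i) - real i + 1/2 else 0)))"

definition extended_y :: "positions \<Rightarrow> positions" where
  "extended_y y = (\<lambda>(n, m, j). if j = n then - real n + 1/2 else y (n, m, j))"

definition block_count :: "nat \<Rightarrow> positions \<Rightarrow> positions \<Rightarrow> nat \<times> nat \<times> nat \<Rightarrow> nat" where
  "block_count k x yt = (\<lambda>(n, l, i).
     card {m \<in> {1..k}. m > l \<and> (\<exists>j\<in>{1..n}. extended_y yt (n, m, j) \<le> x (n, l, i) \<and> x (n, l, i) \<le> x (n, m, j))} +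
     card {m \<in> {1..k}. m < l \<and> (\<exists>j\<in>{1..n}. extended_y yt (n, m, j) \<le> x (n, l, i) + 1 \<and> x (n, l, i) + 1 \<le> x (n, m, j))})"

definition jump ::
  "nat \<Rightarrow> nat \<Rightarrow> (nat \<Rightarrow> real) \<Rightarrow> (nat \<Rightarrow> real) \<Rightarrow> real \<Rightarrow> positions \<Rightarrow> positions \<Rightarrow> nat \<times> nat \<times> nat \<Rightarrow> real pmf" where
  "jump k N c b t x yt = (\<lambda>(n, l, i).
     if x (n, l, i) = extended_y yt (n, l, i) - 1 then return_pmf (x (n, l, i) + 1)
     else if i \<ge> 2 \<and> x (n, l, i) = extended_y yt (n, l, i - 1) - 1 then return_pmf (x (n, l, i))
     else (let q = c n * b (N + 2 - n) * t ^ block_count k x yt (n, l, i)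
           in map_pmf (\<lambda>s. if s then x (n, l, i) + 1 else x (n, l, i)) (bernoulli_pmf (q / (1 + q)))))"

definition particle_update ::
  "nat \<Rightarrow> nat \<Rightarrow> (nat \<Rightarrow> real) \<Rightarrow> (nat \<Rightarrow> real) \<Rightarrow> real \<Rightarrow> positions \<times> positions \<Rightarrow> (positions \<times> positions) pmf" where
  "particle_update k N c b t = (\<lambda>(x, y).
     let yt = (\<lambda>(n, l, i). if (n, l, i) \<in> y_indices k N then x (n - 1, l, i) else 0)
     in map_pmf (\<lambda>xt. (xt, yt)) (Pi_pmf (x_indices k N) 0 (jump k N c b t x yt)))"

end

theory Submission
  imports Defs
begin

text \<open>
  Fix a level \<open>n\<close>, and write \<open>L = Lam n\<close> for its current tuple and \<open>M = Lam (n - 1)\<close> for the tuple that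
  becomes the new \<open>Mu n\<close>. In the weight of the new tuple \<open>K\<close>, the polynomials
  \<open>LLT k K empty_ptuple n c t\<close> of \<open>p_up\<close> and \<open>p_down\<close> cancel. What remains is, up to
  a constant, the product of the dual weight of \<open>K / L\<close> and the one-variable polynomial of \<open>K / M\<close>,
  and both are monomials. Their supports require each row of \<open>K\<close> to exceed that of \<open>L\<close> by 0 or 1, and
  \<open>K\<close> to interlace with \<open>M\<close>. Since \<open>L\<close> interlaces, and \<open>M\<close> co-interlaces, with the old \<open>Mu n\<close>,
  these requirements decouple into one condition per row: a row that is one cell shorter than
  that of \<open>M\<close> must grow, a row as long as the preceding row of \<open>M\<close> must not, and every other row is
  free. These are the first two rules of the particle dynamics.

  Each grown row contributes \<open>c n\<close> times the parameter of the dual weight, so that independence of the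
  rows is a question about the exponent of \<open>t\<close>. This exponent is the sum of the coinversion
  statistic of \<open>K / M\<close> and the dual exponent of \<open>K / L\<close>. Both are sums over pairs of rows of different
  colours. For a single pair, each of the two depends on the two increments with an
  interaction term; the interactions cancel (\<open>overlap_identity\<close>), and the coefficients of the linear
  terms are the indicators that \<open>block_count\<close> counts. The exponent is therefore linear in the
  increments up to a constant (\<open>exponent_identity\<close>), and the weight of \<open>K\<close> is proportional to a
  product of probabilities over rows. As the law of \<open>K\<close> is the normalization of its weight, this
  product is the law (\<open>P_tilde_eq_step\<close>), without any evaluation of the normalizing constant.

  The hypothesis on the state enters only through the interlacing relations, which hold wherever
  the weight of the process is nonzero. To extract them from membership in the support, the
  weight has to be normalizable, and it is, since only finitely many states have nonzero
  weight (\<open>llt_process_support\<close>).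
\<close>


section \<open>Probability mass functions\<close>

lemma pmf_eq_on_support:
  fixes p q :: "'a pmf"
  assumes "\<And>x. x \<in> set_pmf p \<Longrightarrow> pmf p x = pmf q x"
  shows "p = q"
proof (rule ccontr)
  assume "p \<noteq> q"
  then obtain x where "pmf q x < pmf p x"
    using pmf_neq_exists_less[of q p] by auto
  then have "x \<in> set_pmf p"
    using pmf_nonneg[of q x] by (auto simp: set_pmf_iff)
  with assms \<open>pmf q x < pmf p x\<close> show False by simp
qed

text \<open>
  The total mass of a weight that is proportional to a known probability mass function never
  has to be computed.
\<close>

lemma normalized_pmf_eqI:
  assumes supp: "set_pmf Q \<subseteq> A" and "C \<noteq> 0" and w: "\<And>x. x \<in> A \<Longrightarrow> w x = C * pmf Q x"
  shows "normalized_pmf A w = Q"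
proof -
  have "infsum w A = infsum (\<lambda>x. C * pmf Q x) A"
    using w by (rule infsum_cong)
  also have "\<dots> = C * infsum (pmf Q) A"
    by (rule infsum_cmult_right')
  also have "infsum (pmf Q) A = 1"
    using infsetsum_pmf_eq_1[OF supp] infsetsum_infsum[OF pmf_abs_summable[of Q A]] by simp
  finally have "infsum w A = C" by simp
  then have "(\<lambda>x. if x \<in> A then w x / infsum w A else 0) = pmf Q"
    using w \<open>C \<noteq> 0\<close> supp by (auto simp: fun_eq_iff pmf_eq_0_set_pmf)
  then show ?thesis
    unfolding normalized_pmf_def
    using type_definition.Rep_inverse[OF td_pmf_embed_pmf, of Q] by simp
qed


section \<open>Positivity of LLT polynomials\<close>

lemma is_partition_antimono:
  assumes "is_partition p" "1 \<le> i" "i \<le> j"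
  shows "p j \<le> p i"
  using assms(3,2)
proof (induction rule: dec_induct)
  case (step m)
  then show ?case
    using assms(1) unfolding is_partition_def by (meson le_trans)
qed simp

lemma ptuple_antimono:
  assumes "L \<in> ptuples k" "1 \<le> i" "i \<le> j"
  shows "L a j \<le> L a i"
  using assms is_partition_antimono[of "L a"] unfolding ptuples_def by (cases "a \<in> {1..k}") auto

lemma ptuple_row_0: "L \<in> ptuples k \<Longrightarrow> L a 0 = 0"
  unfolding ptuples_def is_partition_def by (cases "a \<in> {1..k}") auto

lemma ptuple_outside: "L \<in> ptuples k \<Longrightarrow> a \<notin> {1..k} \<Longrightarrow> L a i = 0"
  unfolding ptuples_def by auto

lemma finite_ptuple_rows: "L \<in> ptuples k \<Longrightarrow> finite {i. L a i \<noteq> 0}"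
  unfolding ptuples_def is_partition_def by (cases "a \<in> {1..k}") auto

lemma empty_ptuple_in_ptuples: "empty_ptuple \<in> ptuples k"
  by (auto simp: empty_ptuple_def ptuples_def is_partition_def)

lemma finite_skew_cells:
  assumes "L \<in> ptuples k"
  shows "finite (skew_cells k L M)"
proof (rule finite_subset)
  show "skew_cells k L M \<subseteq> (SIGMA a:{1..k}. SIGMA i:{i. L a i \<noteq> 0}. {1..L a i})"
    by (auto simp: skew_cells_def)
qed (use finite_ptuple_rows[OF assms] in auto)

lemma finite_ssfillings:
  assumes "L \<in> ptuples k"
  shows "finite (ssfillings k L M n)"
  by (rule finite_subset[of _ "skew_cells k L M \<rightarrow>\<^sub>E {1..n}"])
     (auto simp: ssfillings_def intro!: finite_PiE finite_skew_cells assms)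

lemma LLT_summand_pos:
  fixes x :: "nat \<Rightarrow> real"
  assumes "\<And>i. i \<in> {1..n} \<Longrightarrow> x i > 0" "t > 0" "\<sigma> \<in> ssfillings k L M n"
  shows "(\<Prod>u\<in>skew_cells k L M. x (\<sigma> u)) * t ^ coinv k L M \<sigma> > 0"
  using assms by (auto simp: ssfillings_def PiE_iff intro!: mult_pos_pos prod_pos)

lemma LLT_nonneg:
  assumes "\<And>i. i \<in> {1..n} \<Longrightarrow> x i > 0" "t > 0"
  shows "LLT k L M n x t \<ge> 0"
proof -
  have "(\<Sum>\<sigma>\<in>ssfillings k L M n. (\<Prod>u\<in>skew_cells k L M. x (\<sigma> u)) * t ^ coinv k L M \<sigma>) \<ge> 0"
    by (rule sum_nonneg) (rule less_imp_le[OF LLT_summand_pos[of n x t, OF assms]])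
  then show ?thesis by (simp add: LLT_def)
qed

text \<open>
  A shape with at most \<open>n\<close> rows has the semistandard filling that puts \<open>i\<close> in every cell of row \<open>i\<close>.
\<close>

lemma LLT_pos:
  assumes L: "L \<in> ptuples k" and rows: "\<And>a i. a \<in> {1..k} \<Longrightarrow> n < i \<Longrightarrow> L a i = 0"
    and "\<And>i. i \<in> {1..n} \<Longrightarrow> x i > 0" "t > 0"
  shows "LLT k L empty_ptuple n x t > 0"
proof -
  have "restrict (\<lambda>(a, i, j). i) (skew_cells k L empty_ptuple) \<in> ssfillings k L empty_ptuple n"
    using rows by (force simp: ssfillings_def skew_cells_def not_less[symmetric])
  moreover have "contained k empty_ptuple L"
    by (simp add: contained_def empty_ptuple_def)
  moreover have "(\<Sum>\<sigma>\<in>ssfillings k L empty_ptuple n.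
      (\<Prod>u\<in>skew_cells k L empty_ptuple. x (\<sigma> u)) * t ^ coinv k L empty_ptuple \<sigma>) > 0"
    if "ssfillings k L empty_ptuple n \<noteq> {}"
    by (rule sum_pos[OF finite_ssfillings[OF L] that]) (rule LLT_summand_pos[of n x t, OF assms(3,4)])
  ultimately show ?thesis by (auto simp: LLT_def)
qed

section \<open>LLT polynomials in one variable\<close>

abbreviation ones :: "nat \<Rightarrow> ptuple \<Rightarrow> ptuple \<Rightarrow> nat \<times> nat \<times> nat \<Rightarrow> nat" where
  "ones k L M \<equiv> restrict (\<lambda>_. 1) (skew_cells k L M)"

definition interlace :: "nat \<Rightarrow> ptuple \<Rightarrow> ptuple \<Rightarrow> bool" where
  "interlace k L M \<longleftrightarrow> (\<forall>a\<in>{1..k}. \<forall>i\<ge>1. M a i \<le> L a i \<and> L a (Suc i) \<le> M a i)"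

lemma ssfillings_1_iff:
  assumes L: "L \<in> ptuples k" and M: "M \<in> ptuples k" and "contained k M L"
  shows "ssfillings k L M 1 = (if interlace k L M then {ones k L M} else {})"
proof -
  have ones: "\<sigma> = ones k L M" if "\<sigma> \<in> ssfillings k L M 1" for \<sigma>
    using that unfolding ssfillings_def by (auto simp: PiE_iff fun_eq_iff extensional_def)
  have "interlace k L M" if "ones k L M \<in> ssfillings k L M 1"
    unfolding interlace_def
  proof (intro ballI allI impI conjI)
    fix a i :: nat assume a: "a \<in> {1..k}" and i: "1 \<le> i"
    show "M a i \<le> L a i" using assms a i by (simp add: contained_def)
    show "L a (Suc i) \<le> M a i"
      \<comment> \<open>otherwise rows \<open>i\<close> and \<open>i + 1\<close> both have a cell in column \<open>L a (Suc i)\<close>\<close>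
    proof (rule ccontr)
      assume "\<not> L a (Suc i) \<le> M a i"
      then have "(a, i, L a (Suc i)) \<in> skew_cells k L M" "(a, Suc i, L a (Suc i)) \<in> skew_cells k L M"
        using a i ptuple_antimono[OF L i, of "Suc i" a] ptuple_antimono[OF M i, of "Suc i" a]
        by (auto simp: skew_cells_def)
      moreover from this have "ones k L M (a, i, L a (Suc i)) < ones k L M (a, Suc i, L a (Suc i))"
        using that lessI[of i] unfolding ssfillings_def by blast
      ultimately show False by simp
    qed
  qed
  moreover have "ones k L M \<in> ssfillings k L M 1" if I: "interlace k L M"
  proof -
    have False if "(a, i, j) \<in> skew_cells k L M" "(a, i', j) \<in> skew_cells k L M" "i < i'" for a i i' j
    proof -
      from that have a: "a \<in> {1..k}" "1 \<le> i" "M a i < j" "j \<le> L a i'"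
        by (auto simp: skew_cells_def)
      then have "L a (Suc i) \<le> M a i" using I by (simp add: interlace_def)
      moreover have "L a i' \<le> L a (Suc i)" using that(3) by (intro ptuple_antimono[OF L]) auto
      ultimately show False using a by simp
    qed
    then show ?thesis by (auto simp: ssfillings_def)
  qed
  ultimately show ?thesis using ones by auto
qed

text \<open>
  Entries in \<open>{1}\<close> increase strictly along columns only if no column has two cells, so a filling
  exists exactly for interlacing shapes, and is unique. Hence the sum has at most one term.
\<close>

lemma LLT_1:
  assumes L: "L \<in> ptuples k" and M: "M \<in> ptuples k"
  shows "LLT k L M 1 x t =
    (if interlace k L M then x 1 ^ card (skew_cells k L M) * t ^ coinv k L M (ones k L M) else 0)"
proof (cases "contained k M L")
  case True
  then show ?thesis
    unfolding LLT_def ssfillings_1_iff[OF assms True] by simp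
next
  case False
  then have "\<not> interlace k L M" by (auto simp: contained_def interlace_def)
  with False show ?thesis by (simp add: LLT_def)
qed

section \<open>One level of the update\<close>

lemma int_card_filter: "finite A \<Longrightarrow> int (card {x \<in> A. P x}) = (\<Sum>x\<in>A. of_bool (P x))"
  by (simp add: Int_def)

text \<open>
  \<open>L\<close> is a tuple of the current state and \<open>M\<close> the tuple that its successor has to interlace with,
  so that \<open>M\<close> is the current tuple one level below. The two need not interlace themselves:
  the bound \<open>M_le\<close> leaves room for rows in which \<open>L\<close> is one cell too short, and these rows must grow.
\<close>

locale level_configuration =
  fixes k n :: nat and L M :: ptuple
  assumes n_pos: "1 \<le> n" and L_ptuple: "L \<in> ptuples k" and M_ptuple: "M \<in> ptuples k"
    and L_rows: "\<And>a i. n < i \<Longrightarrow> L a i = 0" and M_rows: "\<And>a i. n \<le> i \<Longrightarrow> M a i = 0"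
    and M_le: "\<And>a i. M a i \<le> Suc (L a i)" and L_le: "\<And>a i. 1 \<le> i \<Longrightarrow> L a (Suc i) \<le> M a i"
begin

definition rows :: "(nat \<times> nat) set" where
  "rows = {1..k} \<times> {1..n}"

definition successors :: "ptuple set" where
  "successors = {K \<in> ptuples k. interlace k K M \<and> cointerlace k K L}"

text \<open>
  In terms of the particles at the positions \<open>int (L a i) - int i\<close> and \<open>int (M a i) - int i\<close>, both
  shifted by one half, this is the number that enters the jump probability.
\<close>

definition blocks :: "nat \<Rightarrow> nat \<Rightarrow> nat" where
  "blocks l i =
     card {m \<in> {1..k}. m > l \<and> (\<exists>j\<in>{1..n}.
       int (M m j) - int j \<le> int (L l i) - int i \<and> int (L l i) - int i \<le> int (L m j) - int j)} +
     card {m \<in> {1..k}. m < l \<and> (\<exists>j\<in>{1..n}.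
       int (M m j) - int j \<le> int (L l i) - int i + 1 \<and> int (L l i) - int i + 1 \<le> int (L m j) - int j)}"

lemma finite_rows: "finite rows"
  by (simp add: rows_def)

lemma successorsD:
  assumes "K \<in> successors"
  shows "K \<in> ptuples k"
    and "a \<in> {1..k} \<Longrightarrow> 1 \<le> i \<Longrightarrow> M a i \<le> K a i"
    and "a \<in> {1..k} \<Longrightarrow> 1 \<le> i \<Longrightarrow> K a (Suc i) \<le> M a i"
    and "a \<in> {1..k} \<Longrightarrow> 1 \<le> i \<Longrightarrow> K a i = L a i \<or> K a i = Suc (L a i)"
    and "n < i \<Longrightarrow> K a i = 0"
proof -
  show K: "K \<in> ptuples k" using assms by (simp add: successors_def)
  show "M a i \<le> K a i" if "a \<in> {1..k}" "1 \<le> i" for a i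
    using assms that by (simp add: successors_def interlace_def)
  show le: "K a (Suc i) \<le> M a i" if "a \<in> {1..k}" "1 \<le> i" for a i
    using assms that by (simp add: successors_def interlace_def)
  show "K a i = L a i \<or> K a i = Suc (L a i)" if "a \<in> {1..k}" "1 \<le> i"
  proof -
    have "int (K a i) - int (L a i) \<in> {0, 1}"
      using assms that by (simp add: successors_def cointerlace_def)
    then show ?thesis by auto
  qed
  show "K a i = 0" if "n < i"
  proof (cases "a \<in> {1..k}")
    case True
    have i: "1 \<le> i - 1" "n \<le> i - 1" "Suc (i - 1) = i" using that n_pos by auto
    then show ?thesis using le[OF True i(1)] M_rows[OF i(2), of a] by simp
  qed (simp add: ptuple_outside[OF K])
qed

text \<open>
  \<open>L a (Suc i) \<le> M a i\<close> separates the windows \<open>{int (M a j) - int j .. int (L a j) - int j}\<close> of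
  distinct rows. So the colours for which some window contains a given point may be counted by
  summing over rows, which is how the statistics on fillings are expressed.
\<close>

lemma window_unique:
  assumes "1 \<le> j" "1 \<le> j'"
    and "int (M a j) - int j \<le> s" "s \<le> int (L a j) - int j"
    and "int (M a j') - int j' \<le> s" "s \<le> int (L a j') - int j'"
  shows "j = j'"
proof -
  have "False" if "1 \<le> i" "i < i'" "int (M a i) - int i \<le> s" "s \<le> int (L a i') - int i'" for i i'
  proof -
    have "L a i' \<le> L a (Suc i)" using that by (intro ptuple_antimono[OF L_ptuple]) auto
    also have "\<dots> \<le> M a i" using that by (intro L_le)
    finally show False using that by simp
  qed
  from this[of j j'] this[of j' j] assms show ?thesis by (cases j j' rule: linorder_cases) auto
qed

lemma card_windows:
  "int (card {m \<in> {1..k}. P m \<and> (\<exists>j\<in>{1..n}. int (M m j) - int j \<le> s \<and> s \<le> int (L m j) - int j)}) =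
   (\<Sum>(m, j)\<in>rows. of_bool (P m \<and> int (M m j) - int j \<le> s \<and> s \<le> int (L m j) - int j))"
  (is "int (card ?A) = (\<Sum>(m, j)\<in>rows. of_bool (?Q m j))")
proof -
  let ?B = "{(m, j). (m, j) \<in> rows \<and> ?Q m j}"
  have "?A = fst ` ?B"
    by (force simp: rows_def)
  moreover have "inj_on fst ?B"
    by (auto simp: inj_on_def rows_def intro: window_unique)
  ultimately have "card ?A = card ?B"
    by (simp add: card_image)
  also have "?B = {p \<in> rows. case p of (m, j) \<Rightarrow> ?Q m j}"
    by auto
  also have "int (card \<dots>) = (\<Sum>p\<in>rows. of_bool (case p of (m, j) \<Rightarrow> ?Q m j))"
    using finite_rows by (simp add: Int_def)
  finally show ?thesis by (simp add: case_prod_unfold)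
qed

lemma sum_blocks:
  fixes e :: "nat \<Rightarrow> nat \<Rightarrow> nat"
  shows "int (\<Sum>(a, i)\<in>rows. e a i * blocks a i) =
    (\<Sum>(a, i)\<in>rows. \<Sum>(b, j)\<in>rows. of_bool (a < b) *
       (int (e a i) * of_bool (int (M b j) - int j \<le> int (L a i) - int i \<and>
          int (L a i) - int i \<le> int (L b j) - int j) +
        int (e b j) * of_bool (int (M a i) - int i \<le> int (L b j) - int j + 1 \<and>
          int (L b j) - int j + 1 \<le> int (L a i) - int i)))"
proof -
  have "int (\<Sum>(a, i)\<in>rows. e a i * blocks a i) =
    (\<Sum>(a, i)\<in>rows. \<Sum>(b, j)\<in>rows. of_bool (a < b) * (int (e a i) *
       of_bool (int (M b j) - int j \<le> int (L a i) - int i \<and> int (L a i) - int i \<le> int (L b j) - int j))) +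
    (\<Sum>(b, j)\<in>rows. \<Sum>(a, i)\<in>rows. of_bool (a < b) * (int (e b j) *
       of_bool (int (M a i) - int i \<le> int (L b j) - int j + 1 \<and> int (L b j) - int j + 1 \<le> int (L a i) - int i)))"
    unfolding of_nat_sum sum.distrib[symmetric]
  proof (intro sum.cong[OF refl], clarify)
    fix a i
    show "int (e a i * blocks a i) =
      (\<Sum>(b, j)\<in>rows. of_bool (a < b) * (int (e a i) *
         of_bool (int (M b j) - int j \<le> int (L a i) - int i \<and> int (L a i) - int i \<le> int (L b j) - int j))) +
      (\<Sum>(b, j)\<in>rows. of_bool (b < a) * (int (e a i) *
         of_bool (int (M b j) - int j \<le> int (L a i) - int i + 1 \<and> int (L a i) - int i + 1 \<le> int (L b j) - int j)))"
      unfolding blocks_def of_nat_mult of_nat_add card_windows distrib_left sum_distrib_left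
      by (intro arg_cong2[of _ _ _ _ "(+)"] sum.cong) auto
  qed
  also have "(\<Sum>(b, j)\<in>rows. \<Sum>(a, i)\<in>rows. of_bool (a < b) * (int (e b j) *
       of_bool (int (M a i) - int i \<le> int (L b j) - int j + 1 \<and> int (L b j) - int j + 1 \<le> int (L a i) - int i))) =
    (\<Sum>(a, i)\<in>rows. \<Sum>(b, j)\<in>rows. of_bool (a < b) * (int (e b j) *
       of_bool (int (M a i) - int i \<le> int (L b j) - int j + 1 \<and> int (L b j) - int j + 1 \<le> int (L a i) - int i)))"
    unfolding case_prod_unfold by (rule sum.swap)
  finally show ?thesis
    by (simp add: case_prod_unfold sum.distrib[symmetric] distrib_left)
qed

section \<open>The exponent of the coinversion parameter\<close>

text \<open>
  With all entries equal to 1, the comparisons that define a coinversion triple only ask that the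
  left position is not beyond the end of the row and the right one is outside the inner shape;
  the filling disappears from the statistic.
\<close>

lemma entry_ones:
  assumes "K \<in> successors" "b \<in> {1..k}" "1 \<le> j"
  shows "entry K M (ones k K M) b j s \<le> enat 1 \<longleftrightarrow> s \<le> int (K b j)"
    and "enat 1 \<le> entry K M (ones k K M) b j s \<longleftrightarrow> int (M b j) < s"
  using successorsD(2)[OF assms] assms(2,3)
  by (auto simp: entry_def skew_cells_def one_enat_def zero_enat_def)

lemma card_nat_between:
  fixes lo hi :: int
  assumes "0 \<le> lo"
  shows "int (card {r::nat. lo < int r \<and> int r \<le> hi}) = max 0 (hi - lo)"
proof -
  have "{r::nat. lo < int r \<and> int r \<le> hi} = {nat lo<..nat hi}"
    using assms by (auto simp: nat_less_iff nat_le_iff le_nat_iff)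
  then show ?thesis using assms by simp
qed

text \<open>
  For fixed rows \<open>(a, i)\<close> and \<open>(b, j)\<close>, the coinversion triples correspond to the contents
  (column minus row) in the intersection of two half-open intervals. Rows below the first \<open>n\<close>
  contribute nothing, although an empty row does form triples with cells of content far enough
  down: the contents of cells in the first \<open>n\<close> rows are too large for these.
\<close>

lemma coinv_ones:
  assumes K: "K \<in> successors"
  shows "int (coinv k K M (ones k K M)) =
    (\<Sum>(a, i)\<in>rows. \<Sum>(b, j)\<in>rows. of_bool (a < b) *
       max 0 (min (int (K a i) - int i) (int (K b j) - int j + 1) -
              max (int (M a i) - int i) (int (M b j) - int j)))"
proof -
  define R where "R = (\<lambda>((a, i), (b, j)). {r::nat. max (int (M a i)) (int (M b j) - int j + int i) < int r \<and>
     int r \<le> min (int (K a i)) (int (K b j) - int j + 1 + int i)})"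
  define T where "T = {(p, q). p \<in> rows \<and> q \<in> rows \<and> fst p < fst q}"
  have finT: "finite T"
    by (rule finite_subset[of _ "rows \<times> rows"]) (auto simp: T_def finite_rows)
  have finR: "finite (R pq)" for pq
  proof -
    have "R pq \<subseteq> {0..K (fst (fst pq)) (snd (fst pq))}"
      by (auto simp: R_def case_prod_unfold)
    then show ?thesis by (rule finite_subset) simp
  qed
  define C where "C = {((a, i, r), (b, j)).
     (a, i, r) \<in> skew_cells k K M \<and> a < b \<and> b \<le> k \<and> 1 \<le> j \<and>
     entry K M (ones k K M) b j (int r + int j - int i - 1) \<le> enat (ones k K M (a, i, r)) \<and>
     enat (ones k K M (a, i, r)) \<le> entry K M (ones k K M) b j (int r + int j - int i)}"
  have "C = (\<lambda>(((a, i), (b, j)), r). ((a, i, r), (b, j))) ` (SIGMA pq:T. R pq)"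
  proof (intro equalityI subsetI; clarify)
    fix a i r b j
    assume "((a, i, r), (b, j)) \<in> C"
    then have A: "(a, i, r) \<in> skew_cells k K M" "a < b" "b \<le> k" "1 \<le> j"
      and le: "entry K M (ones k K M) b j (int r + int j - int i - 1) \<le> enat (ones k K M (a, i, r))"
      and ge: "enat (ones k K M (a, i, r)) \<le> entry K M (ones k K M) b j (int r + int j - int i)"
      unfolding C_def by auto
    from A have a: "a \<in> {1..k}" "1 \<le> i" "M a i < r" "r \<le> K a i" and b: "b \<in> {1..k}"
      by (auto simp: skew_cells_def)
    from le ge A(1) have r: "int r + int j - int i - 1 \<le> int (K b j)" "int (M b j) < int r + int j - int i"
      using entry_ones[OF K b A(4)] by auto
    have "i \<le> n"
      using successorsD(5)[OF K, of i a] a by (cases "i \<le> n") auto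
    have "j \<le> n"
    proof (rule ccontr)
      assume "\<not> j \<le> n"
      then have "K b j = 0" using successorsD(5)[OF K] by simp
      with r a \<open>i \<le> n\<close> \<open>\<not> j \<le> n\<close> show False by linarith
    qed
    show "((a, i, r), (b, j)) \<in> (\<lambda>(((a, i), (b, j)), r). ((a, i, r), (b, j))) ` (SIGMA pq:T. R pq)"
      using a b r \<open>i \<le> n\<close> \<open>j \<le> n\<close> A
      by (intro rev_image_eqI[of "(((a, i), (b, j)), r)"]) (auto simp: T_def R_def rows_def)
  next
    fix a i b j r
    assume T: "((a, i), (b, j)) \<in> T" and R: "r \<in> R ((a, i), (b, j))"
    from T R have cell: "(a, i, r) \<in> skew_cells k K M"
      by (auto simp: T_def R_def rows_def skew_cells_def)
    from T have b: "b \<in> {1..k}" "1 \<le> j" by (auto simp: T_def rows_def)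
    show "((a, i, r), (b, j)) \<in> C"
      using cell entry_ones[OF K b] T R by (auto simp: C_def T_def R_def rows_def)
  qed
  then have "coinv k K M (ones k K M) = card ((\<lambda>(((a, i), (b, j)), r). ((a, i, r), (b, j))) ` (SIGMA pq:T. R pq))"
    by (simp add: coinv_def C_def)
  also have "\<dots> = card (SIGMA pq:T. R pq)"
    by (rule card_image) (auto simp: inj_on_def)
  also have "\<dots> = (\<Sum>pq\<in>T. card (R pq))"
    using finT finR by (intro card_SigmaI) auto
  also have "int \<dots> = (\<Sum>pq\<in>T. case pq of ((a, i), (b, j)) \<Rightarrow>
       max 0 (min (int (K a i) - int i) (int (K b j) - int j + 1) -
              max (int (M a i) - int i) (int (M b j) - int j)))"
    unfolding of_nat_sum
    by (rule sum.cong[OF refl]) (auto simp: R_def card_nat_between min_def max_def)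
  also have "\<dots> = (\<Sum>pq\<in>rows \<times> rows. case pq of ((a, i), (b, j)) \<Rightarrow> of_bool (a < b) *
       max 0 (min (int (K a i) - int i) (int (K b j) - int j + 1) -
              max (int (M a i) - int i) (int (M b j) - int j)))"
    by (rule sum.mono_neutral_cong_left) (auto simp: T_def finite_rows)
  finally show ?thesis
    by (simp add: sum.cartesian_product case_prod_unfold)
qed

lemma dual_exponent_sum:
  assumes K: "K \<in> successors"
  shows "int (dual_exponent k K L) =
    (\<Sum>(a, i)\<in>rows. \<Sum>(b, j)\<in>rows. of_bool (a < b) *
       of_bool (K a i = L a i \<and> K b j = Suc (L b j) \<and> int (L b j) - int j + 1 = int (L a i) - int i))"
proof -
  define T where "T = {pq. pq \<in> rows \<times> rows \<and> (case pq of ((a, i), (b, j)) \<Rightarrow> a < b \<and>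
     K a i = L a i \<and> K b j = Suc (L b j) \<and> int (L b j) - int j + 1 = int (L a i) - int i)}"
  have "dual_exponent k K L = card ((\<lambda>((a, i), (b, j)). (a, b, i, j)) ` T)"
    unfolding dual_exponent_def
  proof (intro arg_cong[of _ _ card] set_eqI iffI; clarify)
    fix a b i j
    assume A: "a \<in> {1..k}" "b \<in> {1..k}" "a < b" "1 \<le> i" "1 \<le> j"
      "int (K b j) - int j = int (L b j) - int j + 1"
      "int (L b j) - int j + 1 = int (L a i) - int i" "int (L a i) - int i = int (K a i) - int i"
    then have "j \<le> n" using successorsD(5)[OF K, of j b] by (cases "j \<le> n") auto
    moreover from this A have "i \<le> n" using L_rows[of i a] by (cases "i \<le> n") auto
    ultimately show "(a, b, i, j) \<in> (\<lambda>((a, i), (b, j)). (a, b, i, j)) ` T"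
      using A by (intro rev_image_eqI[of "((a, i), (b, j))"]) (auto simp: T_def rows_def)
  qed (auto simp: T_def rows_def)
  also have "\<dots> = card T"
    by (rule card_image) (auto simp: inj_on_def)
  also have "T = {pq \<in> rows \<times> rows. case pq of ((a, i), (b, j)) \<Rightarrow> a < b \<and>
     K a i = L a i \<and> K b j = Suc (L b j) \<and> int (L b j) - int j + 1 = int (L a i) - int i}"
    unfolding T_def by simp
  finally show ?thesis
    by (simp add: int_card_filter finite_rows sum.cartesian_product case_prod_unfold flip: of_bool_conj del: sum_of_bool_eq)
qed

text \<open>
  The reason for the independence of the particles. Here \<open>ea, eb\<close> are the increments of two
  rows of colours \<open>a < b\<close>. The overlap of two intervals depends on their endpoints jointly, so that the
  coinversion statistic alone has an interaction term \<open>ea * eb\<close>, present when \<open>lb + 1 = la\<close>. Exactly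
  then the dual exponent counts the pair if \<open>eb = 1\<close> and \<open>ea = 0\<close>; its term \<open>- ea * eb\<close> cancels the
  interaction, and its linear term turns the coefficient of \<open>eb\<close> into the indicator of the closed
  window. If \<open>la < ma\<close>, then only \<open>ea = 1\<close> is possible and the overlap is empty; the term
  subtracted on the right offsets the coefficient of \<open>ea\<close> in this case.
\<close>

lemma overlap_identity:
  fixes la ma lb mb ea eb :: int
  assumes "ea \<in> {0, 1}" "eb \<in> {0, 1}" "ma \<le> la + ea" "mb \<le> lb + eb"
  shows "max 0 (min (la + ea) (lb + eb + 1) - max ma mb) + of_bool (ea = 0 \<and> eb = 1 \<and> lb + 1 = la) =
    max 0 (min la (lb + 1) - max ma mb) - of_bool (la < ma \<and> mb \<le> la \<and> la \<le> lb) +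
    (ea * of_bool (mb \<le> la \<and> la \<le> lb) + eb * of_bool (ma \<le> lb + 1 \<and> lb + 1 \<le> la))"
proof -
  from assms(1,2) consider "ea = 0" "eb = 0" | "ea = 1" "eb = 0" | "ea = 0" "eb = 1" | "ea = 1" "eb = 1"
    by auto
  then show ?thesis
    using assms(3,4) unfolding of_bool_def max_def min_def by cases (simp_all, linarith?, (smt (verit))?)
qed

definition base_exponent :: int where
  "base_exponent = (\<Sum>(a, i)\<in>rows. \<Sum>(b, j)\<in>rows. of_bool (a < b) *
     (max 0 (min (int (L a i) - int i) (int (L b j) - int j + 1) -
             max (int (M a i) - int i) (int (M b j) - int j)) -
      of_bool (int (L a i) - int i < int (M a i) - int i \<and>
        int (M b j) - int j \<le> int (L a i) - int i \<and> int (L a i) - int i \<le> int (L b j) - int j)))"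

text \<open>
  Up to a constant that depends only on \<open>L\<close> and \<open>M\<close>, the total exponent of \<open>t\<close> is linear in the
  increments of the rows.
\<close>

lemma exponent_identity:
  assumes K: "K \<in> successors"
  shows "int (dual_exponent k K L + coinv k K M (ones k K M)) =
    base_exponent + int (\<Sum>(a, i)\<in>rows. (K a i - L a i) * blocks a i)"
proof -
  define x where "x = (\<lambda>a i. int (L a i) - int i)"
  define y where "y = (\<lambda>a i. int (M a i) - int i)"
  define e where "e = (\<lambda>a i. int (K a i - L a i))"
  have e: "int (K a i) - int i = x a i + e a i" "e a i \<in> {0, 1}" "y a i \<le> x a i + e a i"
      "K a i = L a i \<longleftrightarrow> e a i = 0" "K a i = Suc (L a i) \<longleftrightarrow> e a i = 1"
    if "(a, i) \<in> rows" for a i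
    using successorsD(2,4)[OF K, of a i] that by (auto simp: x_def y_def e_def rows_def)
  have "int (coinv k K M (ones k K M)) + int (dual_exponent k K L) =
    (\<Sum>(a, i)\<in>rows. \<Sum>(b, j)\<in>rows. of_bool (a < b) *
       max 0 (min (int (K a i) - int i) (int (K b j) - int j + 1) - max (y a i) (y b j))) +
    (\<Sum>(a, i)\<in>rows. \<Sum>(b, j)\<in>rows. of_bool (a < b) *
       of_bool (K a i = L a i \<and> K b j = Suc (L b j) \<and> x b j + 1 = x a i))"
    unfolding coinv_ones[OF K] dual_exponent_sum[OF K] x_def y_def ..
  also have "\<dots> = (\<Sum>(a, i)\<in>rows. \<Sum>(b, j)\<in>rows. of_bool (a < b) *
       (max 0 (min (x a i + e a i) (x b j + e b j + 1) - max (y a i) (y b j)) +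
        of_bool (e a i = 0 \<and> e b j = 1 \<and> x b j + 1 = x a i)))"
    unfolding sum.distrib[symmetric] case_prod_unfold distrib_left[symmetric]
    by (intro sum.cong refl) (simp add: e)
  also have "\<dots> = (\<Sum>(a, i)\<in>rows. \<Sum>(b, j)\<in>rows. of_bool (a < b) *
       (max 0 (min (x a i) (x b j + 1) - max (y a i) (y b j)) -
        of_bool (x a i < y a i \<and> y b j \<le> x a i \<and> x a i \<le> x b j) +
        (e a i * of_bool (y b j \<le> x a i \<and> x a i \<le> x b j) +
         e b j * of_bool (y a i \<le> x b j + 1 \<and> x b j + 1 \<le> x a i))))"
    unfolding case_prod_unfold
    by (intro sum.cong refl arg_cong2[of _ _ _ _ "(*)"] overlap_identity e) simp_all
  also have "\<dots> = base_exponent + int (\<Sum>(a, i)\<in>rows. (K a i - L a i) * blocks a i)"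
    unfolding sum_blocks base_exponent_def x_def y_def e_def
    unfolding case_prod_unfold sum.distrib[symmetric] distrib_left[symmetric] ..
  finally show ?thesis by simp
qed


section \<open>The successor of a level\<close>

lemma ptuple_size_rows:
  assumes "K \<in> ptuples k" "\<And>a i. n < i \<Longrightarrow> K a i = 0"
  shows "ptuple_size k K = (\<Sum>(a, i)\<in>rows. K a i)"
proof -
  have "(\<Sum>i | K a i \<noteq> 0. K a i) = (\<Sum>i=1..n. K a i)" for a
  proof (rule sum.mono_neutral_left)
    show "{i. K a i \<noteq> 0} \<subseteq> {1..n}"
    proof
      fix i assume "i \<in> {i. K a i \<noteq> 0}"
      then show "i \<in> {1..n}"
        using assms(2)[of i a] ptuple_row_0[OF assms(1), of a] by (cases "i = 0"; cases "n < i") auto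
    qed
  qed auto
  then show ?thesis
    by (simp add: ptuple_size_def rows_def sum.cartesian_product)
qed

lemma card_skew_cells:
  assumes K: "K \<in> successors"
  shows "int (card (skew_cells k K M)) = (\<Sum>(a, i)\<in>rows. int (K a i) - int (M a i))"
proof -
  have "card (skew_cells k K M) = card ((\<lambda>((a, i), r). (a, i, r)) ` (SIGMA p:rows. {M (fst p) (snd p)<..K (fst p) (snd p)}))"
  proof (intro arg_cong[of _ _ card] set_eqI iffI; clarify)
    fix a i r assume A: "(a, i, r) \<in> skew_cells k K M"
    then have "i \<le> n" using successorsD(5)[OF K, of i a] by (cases "i \<le> n") (auto simp: skew_cells_def)
    then show "(a, i, r) \<in> (\<lambda>((a, i), r). (a, i, r)) ` (SIGMA p:rows. {M (fst p) (snd p)<..K (fst p) (snd p)})"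
      using A by (intro rev_image_eqI[of "((a, i), r)"]) (auto simp: rows_def skew_cells_def)
  qed (auto simp: rows_def skew_cells_def)
  also have "\<dots> = card (SIGMA p:rows. {M (fst p) (snd p)<..K (fst p) (snd p)})"
    by (rule card_image) (auto simp: inj_on_def)
  also have "\<dots> = (\<Sum>p\<in>rows. K (fst p) (snd p) - M (fst p) (snd p))"
    by (simp add: finite_rows)
  also have "int \<dots> = (\<Sum>p\<in>rows. int (K (fst p) (snd p)) - int (M (fst p) (snd p)))"
    unfolding of_nat_sum using successorsD(2)[OF K]
    by (intro sum.cong refl of_nat_diff) (auto simp: rows_def)
  finally show ?thesis by (simp add: case_prod_unfold)
qed

text \<open>
  The weight of a successor is a product over rows, up to a factor independent of the successor.
  The constant exponents may be negative, because \<open>L\<close> need not contain \<open>M\<close>.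
\<close>

lemma weight_successor:
  assumes K: "K \<in> successors" and pos: "\<beta> > 0" "\<gamma> > 0" "t > 0"
  shows "dual_LLT k K L \<beta> t * LLT k K M 1 (\<lambda>_. \<gamma>) t =
    \<gamma> powi (\<Sum>(a, i)\<in>rows. int (L a i) - int (M a i)) * t powi base_exponent *
    (\<Prod>(a, i)\<in>rows. (\<gamma> * \<beta> * t ^ blocks a i) ^ (K a i - L a i))"
proof -
  define J where "J = (\<Sum>(a, i)\<in>rows. K a i - L a i)"
  have le: "L a i \<le> K a i" if "(a, i) \<in> rows" for a i
    using successorsD(4)[OF K, of a i] that by (auto simp: rows_def)
  have sizes: "ptuple_size k K = (\<Sum>(a, i)\<in>rows. K a i)" "ptuple_size k L = (\<Sum>(a, i)\<in>rows. L a i)"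
    by (intro ptuple_size_rows L_ptuple L_rows successorsD[OF K]; assumption)+
  have size: "ptuple_size k K - ptuple_size k L = J"
    unfolding sizes J_def case_prod_unfold by (rule sum_subtractf_nat[symmetric]) (use le in auto)
  have "int (card (skew_cells k K M)) = (\<Sum>(a, i)\<in>rows. int (L a i) - int (M a i)) + int J"
    unfolding card_skew_cells[OF K] J_def of_nat_sum case_prod_unfold sum.distrib[symmetric]
    using le by (intro sum.cong) auto
  then have cells: "\<gamma> ^ card (skew_cells k K M) =
      \<gamma> powi (\<Sum>(a, i)\<in>rows. int (L a i) - int (M a i)) * \<gamma> ^ J"
    using pos by (simp add: power_int_add flip: power_int_of_nat)
  have exponent: "t ^ (dual_exponent k K L + coinv k K M (ones k K M)) =
      t powi base_exponent * t ^ (\<Sum>(a, i)\<in>rows. (K a i - L a i) * blocks a i)"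
    using pos exponent_identity[OF K] by (simp add: power_int_add flip: power_int_of_nat)
  have "dual_LLT k K L \<beta> t * LLT k K M 1 (\<lambda>_. \<gamma>) t =
     \<beta> ^ J * \<gamma> ^ card (skew_cells k K M) * t ^ (dual_exponent k K L + coinv k K M (ones k K M))"
    unfolding dual_LLT_def LLT_1[OF successorsD(1)[OF K] M_ptuple] size
    using K by (simp add: successors_def power_add)
  also have "\<dots> = \<gamma> powi (\<Sum>(a, i)\<in>rows. int (L a i) - int (M a i)) * t powi base_exponent *
     ((\<gamma> * \<beta>) ^ J * t ^ (\<Sum>(a, i)\<in>rows. (K a i - L a i) * blocks a i))"
    unfolding cells exponent by (simp add: power_mult_distrib ac_simps)
  also have "(\<gamma> * \<beta>) ^ J * t ^ (\<Sum>(a, i)\<in>rows. (K a i - L a i) * blocks a i) =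
      (\<Prod>(a, i)\<in>rows. (\<gamma> * \<beta> * t ^ blocks a i) ^ (K a i - L a i))"
    by (simp add: J_def case_prod_unfold power_sum prod.distrib power_mult_distrib mult.commute flip: power_mult)
  finally show ?thesis .
qed

lemma weight_not_successor:
  assumes "K \<in> ptuples k" "K \<notin> successors"
  shows "dual_LLT k K L \<beta> t * LLT k K M 1 x t = 0"
  using assms unfolding dual_LLT_def LLT_1[OF assms(1) M_ptuple] successors_def by simp

definition row_step :: "(nat \<Rightarrow> nat \<Rightarrow> real) \<Rightarrow> nat \<times> nat \<Rightarrow> nat pmf" where
  "row_step q = (\<lambda>(l, i).
     if Suc (L l i) = M l i then return_pmf (Suc (L l i))
     else if i \<ge> 2 \<and> L l i = M l (i - 1) then return_pmf (L l i)
     else map_pmf (\<lambda>s. if s then Suc (L l i) else L l i) (bernoulli_pmf (q l i / (1 + q l i))))"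

text \<open>
  In a row that must grow, the transition probability 1 is written as \<open>q * (1 / q)\<close>; then every row has
  probability \<open>q\<close> to the power of its increment, times a factor that is independent of the increment.
\<close>

definition row_normalizer :: "(nat \<Rightarrow> nat \<Rightarrow> real) \<Rightarrow> nat \<times> nat \<Rightarrow> real" where
  "row_normalizer q = (\<lambda>(l, i).
     if Suc (L l i) = M l i then 1 / q l i
     else if i \<ge> 2 \<and> L l i = M l (i - 1) then 1
     else 1 / (1 + q l i))"

definition row_choices :: "nat \<Rightarrow> nat \<Rightarrow> nat set" where
  "row_choices l i = {v. v \<in> {L l i, Suc (L l i)} \<and> M l i \<le> v \<and> (2 \<le> i \<longrightarrow> v \<le> M l (i - 1))}"

text \<open>
  The increment of a row is constrained by \<open>M\<close> alone, not by the other rows of the new tuple. The cases of the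
  definition are those in which the constraints exclude one of the two increments; both
  cannot be excluded, since \<open>M l i \<le> M l (i - 1)\<close>.
\<close>

lemma pmf_row_step:
  assumes i: "1 \<le> i" and q: "q l i > 0"
  shows "pmf (row_step q (l, i)) v =
    (if v \<in> row_choices l i then q l i ^ (v - L l i) * row_normalizer q (l, i) else 0)"
proof -
  have M_anti: "M l i \<le> M l (i - 1)" if "2 \<le> i"
    using that by (intro ptuple_antimono[OF M_ptuple]) auto
  have L_le': "L l i \<le> M l (i - 1)" if "2 \<le> i"
    using L_le[of "i - 1" l] that by simp
  consider (up) "Suc (L l i) = M l i"
    | (stay) "Suc (L l i) \<noteq> M l i" "2 \<le> i" "L l i = M l (i - 1)"
    | (free) "Suc (L l i) \<noteq> M l i" "\<not> (2 \<le> i \<and> L l i = M l (i - 1))"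
    by blast
  then show ?thesis
  proof cases
    case up
    then show ?thesis
      using q M_anti by (auto simp: row_step_def row_normalizer_def row_choices_def indicator_def simp flip: up)
  next
    case stay
    then show ?thesis
      using M_anti by (auto simp: row_step_def row_normalizer_def row_choices_def indicator_def)
  next
    case free
    let ?f = "\<lambda>s. if s then Suc (L l i) else L l i"
    let ?B = "bernoulli_pmf (q l i / (1 + q l i))"
    have "inj ?f" by (auto simp: inj_def)
    from pmf_map_inj'[OF this, of ?B True] pmf_map_inj'[OF this, of ?B False]
    have "pmf (map_pmf ?f ?B) (Suc (L l i)) = q l i / (1 + q l i)"
      "pmf (map_pmf ?f ?B) (L l i) = 1 / (1 + q l i)"
      using q by (auto simp: field_simps)
    moreover have "pmf (map_pmf ?f ?B) v = 0" if "v \<noteq> L l i" "v \<noteq> Suc (L l i)"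
      using that by (auto simp: pmf_eq_0_set_pmf)
    moreover have "row_choices l i = {L l i, Suc (L l i)}"
      using free M_le[of l i] L_le' unfolding row_choices_def by force
    ultimately show ?thesis
      using free by (auto simp: row_step_def row_normalizer_def)
  qed
qed

definition step :: "(nat \<Rightarrow> nat \<Rightarrow> real) \<Rightarrow> ptuple pmf" where
  "step q = map_pmf curry (Pi_pmf rows 0 (row_step q))"

lemma pmf_step:
  "pmf (step q) K =
     (if \<forall>p. p \<notin> rows \<longrightarrow> case_prod K p = 0 then \<Prod>(l, i)\<in>rows. pmf (row_step q (l, i)) (K l i) else 0)"
proof -
  have "inj (curry :: (nat \<times> nat \<Rightarrow> nat) \<Rightarrow> _)"
    by (rule injI) (metis case_prod_curry)
  from pmf_map_inj'[OF this, of "Pi_pmf rows 0 (row_step q)" "case_prod K"]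
  have "pmf (step q) K = pmf (Pi_pmf rows 0 (row_step q)) (case_prod K)"
    by (simp add: step_def)
  then show ?thesis
    unfolding pmf_Pi[OF finite_rows] by (simp only: case_prod_unfold prod.collapse)
qed

lemma pmf_step_successor:
  assumes K: "K \<in> successors" and q: "\<And>l i. (l, i) \<in> rows \<Longrightarrow> q l i > 0"
  shows "pmf (step q) K = (\<Prod>(l, i)\<in>rows. q l i ^ (K l i - L l i)) * prod (row_normalizer q) rows"
proof -
  have "K a i = 0" if "(a, i) \<notin> rows" for a i
    using that ptuple_outside[OF successorsD(1)[OF K], of a i] successorsD(5)[OF K, of i a]
      ptuple_row_0[OF successorsD(1)[OF K], of a]
    by (cases "i = 0") (auto simp: rows_def not_le)
  then have "pmf (step q) K = (\<Prod>(l, i)\<in>rows. pmf (row_step q (l, i)) (K l i))"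
    by (auto simp: pmf_step)
  also have "\<dots> = (\<Prod>(l, i)\<in>rows. q l i ^ (K l i - L l i) * row_normalizer q (l, i))"
  proof (rule prod.cong[OF refl], clarify)
    fix l i assume li: "(l, i) \<in> rows"
    have "K l i \<in> row_choices l i"
      using li successorsD(2,4)[OF K, of l i] successorsD(3)[OF K, of l "i - 1"]
      by (auto simp: rows_def row_choices_def)
    then show "pmf (row_step q (l, i)) (K l i) = q l i ^ (K l i - L l i) * row_normalizer q (l, i)"
      using li q by (simp add: pmf_row_step rows_def)
  qed
  finally show ?thesis by (simp add: prod.distrib case_prod_unfold)
qed

lemma set_pmf_step:
  assumes q: "\<And>l i. (l, i) \<in> rows \<Longrightarrow> q l i > 0"
  shows "set_pmf (step q) \<subseteq> successors"
proof
  fix K assume "K \<in> set_pmf (step q)"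
  then have nz: "pmf (step q) K \<noteq> 0" by (simp add: set_pmf_iff)
  then have out: "K a i = 0" if "(a, i) \<notin> rows" for a i
    using that by (auto simp: pmf_step split: if_splits)
  have "pmf (row_step q (l, i)) (K l i) \<noteq> 0" if "(l, i) \<in> rows" for l i
    using nz that finite_rows by (auto simp: pmf_step split: if_splits)
  then have choice: "K l i \<in> row_choices l i" if "(l, i) \<in> rows" for l i
    using that pmf_row_step[of i q l "K l i"] q by (force simp: rows_def split: if_splits)
  have ge: "M a i \<le> K a i" if "a \<in> {1..k}" "1 \<le> i" for a i
    using choice[of a i] M_rows[of i a] that by (cases "i \<le> n") (auto simp: rows_def row_choices_def)
  have le: "K a (Suc i) \<le> M a i" if "a \<in> {1..k}" "1 \<le> i" for a i
    using choice[of a "Suc i"] out[of a "Suc i"] that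
    by (cases "Suc i \<le> n") (auto simp: rows_def row_choices_def)
  have "finite {i. K a i \<noteq> 0}" for a
    by (rule finite_subset[of _ "{1..n}"]) (use out[of a] in \<open>force simp: rows_def\<close>)+
  then have "K \<in> ptuples k"
    using order_trans[OF le ge] out unfolding ptuples_def is_partition_def
    by (auto simp: rows_def fun_eq_iff)
  moreover have "cointerlace k K L"
    unfolding cointerlace_def
  proof (intro ballI allI impI)
    fix a i :: nat assume a: "a \<in> {1..k}" and i: "1 \<le> i"
    show "int (K a i) - int (L a i) \<in> {0, 1}"
    proof (cases "i \<le> n")
      case True
      then show ?thesis using choice[of a i] a i by (auto simp: rows_def row_choices_def)
    next
      case False
      then show ?thesis using out[of a i] L_rows[of i a] by (simp add: rows_def)
    qed
  qed
  ultimately show "K \<in> successors"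
    using ge le by (simp add: successors_def interlace_def)
qed

text \<open>
  \<open>p_up\<close> and \<open>p_down\<close> carry the factor \<open>LLT k K empty_ptuple n c t\<close> of the new tuple \<open>K\<close> in the numerator
  and in the denominator. It is nonzero because a tuple interlacing with \<open>M\<close> has at most \<open>n\<close> rows,
  and after its cancellation only the two monomial weights depend on \<open>K\<close>.
\<close>

theorem P_tilde_eq_step:
  assumes c: "\<And>i. i \<in> {1..n} \<Longrightarrow> c i > 0" and pos: "\<beta> > 0" "t > 0"
  shows "P_tilde k n c \<beta> t L M = step (\<lambda>l i. c n * \<beta> * t ^ blocks l i)"
proof -
  define q where "q = (\<lambda>l i. c n * \<beta> * t ^ blocks l i)"
  have cn: "c n > 0" using c n_pos by simp
  have q: "q l i > 0" for l i
    using cn pos by (simp add: q_def)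
  define H where "H = prod (row_normalizer q) rows"
  have H: "H > 0"
    unfolding H_def using q by (intro prod_pos) (auto simp: row_normalizer_def add_pos_pos)
  define D where "D = (\<Prod>i=1..n. \<Prod>l<k. 1 + c i * \<beta> * t ^ l)"
  have D: "D > 0"
    unfolding D_def using c pos by (intro prod_pos) (auto intro!: add_pos_pos)
  \<comment> \<open>\<open>C\<close> collects all factors that do not depend on the new tuple\<close>
  define C where "C = LLT k M empty_ptuple (n - 1) c t / LLT k L empty_ptuple n c t *
    c n powi (\<Sum>(a, i)\<in>rows. int (L a i) - int (M a i)) * t powi base_exponent / (D * H)"
  have "LLT k M empty_ptuple (n - 1) c t > 0"
    using c pos M_rows by (intro LLT_pos[OF M_ptuple]) auto
  moreover have "LLT k L empty_ptuple n c t > 0"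
    using c pos L_rows by (intro LLT_pos[OF L_ptuple]) auto
  ultimately have "C \<noteq> 0"
    using cn pos D H by (simp add: C_def)
  have "p_up k n c \<beta> t L K * p_down k n c t K M = C * pmf (step q) K" if "K \<in> ptuples k" for K
  proof (cases "K \<in> successors")
    case True
    have "LLT k K empty_ptuple n c t > 0"
      using c pos successorsD(5)[OF True] by (intro LLT_pos[OF that]) auto
    then have "p_up k n c \<beta> t L K * p_down k n c t K M =
      LLT k M empty_ptuple (n - 1) c t / LLT k L empty_ptuple n c t / D *
      (dual_LLT k K L \<beta> t * LLT k K M 1 (\<lambda>_. c n) t)"
      by (simp add: p_up_def p_down_def D_def mult.commute mult.left_commute)
    also have "\<dots> = C * pmf (step q) K"
      unfolding weight_successor[OF True pos(1) cn pos(2)] pmf_step_successor[of K q, OF True q] H_def[symmetric]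
      using H by (simp add: C_def q_def)
    finally show ?thesis .
  next
    case False
    with set_pmf_step[of q, OF q] have "pmf (step q) K = 0"
      by (auto simp: pmf_eq_0_set_pmf)
    with weight_not_successor[OF that False, of \<beta> t "\<lambda>_. c n"] show ?thesis
      by (auto simp: p_up_def p_down_def)
  qed
  moreover have "set_pmf (step q) \<subseteq> ptuples k"
    using set_pmf_step[of q, OF q] successorsD(1) by blast
  ultimately show ?thesis
    unfolding P_tilde_def q_def[symmetric] using \<open>C \<noteq> 0\<close> by (intro normalized_pmf_eqI)
qed

end


section \<open>The support of the LLT process\<close>

lemma dual_LLT_nonneg: "0 < y \<Longrightarrow> 0 < t \<Longrightarrow> 0 \<le> dual_LLT k L M y t"
  by (simp add: dual_LLT_def)

lemma empty_ptuple_apply [simp]: "empty_ptuple a i = 0"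
  by (simp add: empty_ptuple_def)

text \<open>
  The states of positive weight. The boundary values make the interlacing conditions hold at
  all levels, including 0 and those above \<open>N\<close>, which spares case distinctions at the ends.
\<close>

locale llt_sequences =
  fixes k N :: nat and Lam Mu :: "nat \<Rightarrow> ptuple"
  assumes Lam_ptuple: "\<And>n. Lam n \<in> ptuples k" and Mu_ptuple: "\<And>n. Mu n \<in> ptuples k"
    and Lam_outside: "\<And>n. n \<notin> {1..N} \<Longrightarrow> Lam n = empty_ptuple"
    and Mu_outside: "\<And>n. n \<notin> {2..N} \<Longrightarrow> Mu n = empty_ptuple"
    and interlace: "\<And>n. interlace k (Lam n) (Mu n)"
    and cointerlace: "\<And>n. cointerlace k (Lam n) (Mu (Suc n))"

lemma llt_sequences_if_weight:
  assumes "(Lam, Mu) \<in> llt_states k N" and w: "llt_weight k N c b t (Lam, Mu) \<noteq> 0"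
  shows "llt_sequences k N Lam Mu"
proof -
  have st: "n \<in> {1..N} \<Longrightarrow> Lam n \<in> ptuples k" "n \<in> {1..N} \<Longrightarrow> Mu n \<in> ptuples k"
      "n \<notin> {1..N} \<Longrightarrow> Lam n = empty_ptuple" "n \<notin> {1..N} \<Longrightarrow> Mu n = empty_ptuple"
      "Mu 1 = empty_ptuple" for n
    using assms(1) unfolding llt_states_def by blast+
  have L: "Lam n \<in> ptuples k" and M: "Mu n \<in> ptuples k" for n
    using st(1-4)[of n] empty_ptuple_in_ptuples by metis+
  have nz: "LLT k (Lam n) (Mu n) 1 (\<lambda>_. c n) t \<noteq> 0"
      "dual_LLT k (Lam n) (Mu (n + 1)) (b (N + 1 - n)) t \<noteq> 0" if "n \<in> {1..N}" for n
    using w that unfolding llt_weight_def by auto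
  show ?thesis
  proof
    fix n
    show "Mu n = empty_ptuple" if "n \<notin> {2..N}"
      using st(4)[of n] st(5) that by (cases "n = 1") auto
    show "interlace k (Lam n) (Mu n)"
    proof (cases "n \<in> {1..N}")
      case True
      from nz(1)[OF this] show ?thesis unfolding LLT_1[OF L M] by (simp split: if_splits)
    qed (simp add: st(3,4) interlace_def)
    show "cointerlace k (Lam n) (Mu (Suc n))"
    proof (cases "n \<in> {1..N}")
      case True
      from nz(2)[OF this] show ?thesis by (simp add: dual_LLT_def split: if_splits)
    next
      case False
      then have "Mu (Suc n) = empty_ptuple" using st(4)[of "Suc n"] st(5) by (cases "n = 0") auto
      with False show ?thesis by (simp add: st(3) cointerlace_def)
    qed
  qed (use L M st(3) in auto)
qed

context llt_sequences
begin

lemma Mu_le: "Mu n a i \<le> Lam n a i"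
  using interlace[of n] ptuple_outside[OF Mu_ptuple] ptuple_row_0[OF Mu_ptuple]
  by (cases "a \<in> {1..k}"; cases "i = 0") (auto simp: interlace_def)

lemma Lam_le: "1 \<le> i \<Longrightarrow> Lam n a (Suc i) \<le> Mu n a i"
  using interlace[of n] ptuple_outside[OF Lam_ptuple]
  by (cases "a \<in> {1..k}") (auto simp: interlace_def)

lemma Mu_Suc: "Mu (Suc n) a i \<le> Lam n a i \<and> Lam n a i \<le> Suc (Mu (Suc n) a i)"
proof (cases "a \<in> {1..k} \<and> i \<ge> 1")
  case True
  then have "int (Lam n a i) - int (Mu (Suc n) a i) \<in> {0, 1}"
    using cointerlace[of n] by (auto simp: cointerlace_def)
  then show ?thesis by auto
next
  case False
  then show ?thesis
    using ptuple_outside[OF Lam_ptuple] ptuple_outside[OF Mu_ptuple]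
      ptuple_row_0[OF Lam_ptuple] ptuple_row_0[OF Mu_ptuple]
    by (cases "i = 0") auto
qed

text \<open>
  Interlacing adds at most one row per level, counted from the empty tuple at level 0.
\<close>

lemma Lam_rows: "n < i \<Longrightarrow> Lam n a i = 0"
proof (induction n arbitrary: i)
  case 0
  then show ?case by (simp add: Lam_outside)
next
  case (Suc n)
  show ?case
  proof (cases "n = 0")
    case True
    then show ?thesis
      using Suc.prems Lam_le[of "i - 1" 1 a] by (simp add: Mu_outside)
  next
    case False
    have "Lam (Suc n) a i \<le> Mu (Suc n) a (i - 1)"
      using Lam_le[of "i - 1" "Suc n" a] Suc.prems False by simp
    also have "\<dots> \<le> Lam n a (i - 1)"
      using Mu_Suc by blast
    also have "\<dots> = 0"
      using Suc.prems by (intro Suc.IH) auto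
    finally show ?thesis by simp
  qed
qed

text \<open>
  Co-interlacing removes at most one cell per row and level on the way to the empty tuple at level
  \<open>N + 1\<close>.
\<close>

lemma Lam_bound: "Lam n a i \<le> N"
proof (cases "n = 0")
  case False
  have "Lam n a i \<le> m" if "N < n + m" for n m
    using that
  proof (induction m arbitrary: n)
    case 0
    then show ?case by (simp add: Lam_outside)
  next
    case (Suc m)
    have "Lam n a i \<le> Suc (Mu (Suc n) a i)" using Mu_Suc by blast
    also have "Mu (Suc n) a i \<le> Lam (Suc n) a i" by (rule Mu_le)
    also have "Lam (Suc n) a i \<le> m" using Suc by simp
    finally show ?case by simp
  qed
  from this[of n N] False show ?thesis by simp
qed (simp add: Lam_outside)

lemma Lam_support: "n \<le> N \<and> a \<le> k \<and> i \<le> N" if "Lam n a i \<noteq> 0"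
proof -
  have n: "n \<le> N" using that Lam_outside[of n] by (cases "n \<le> N") auto
  have "a \<in> {1..k}" using that ptuple_outside[OF Lam_ptuple, of a] by metis
  moreover have "i \<le> n" using that Lam_rows[of n i a] by (cases "i \<le> n") auto
  ultimately show ?thesis using n by simp
qed

text \<open>
  The tuples of two consecutive levels are related through \<open>Mu n\<close>, which interlaces with the upper one
  and co-interlaces with the lower one.
\<close>

lemma level_configuration:
  assumes n: "1 \<le> n"
  shows "level_configuration k n (Lam n) (Lam (n - 1))"
proof
  fix a i
  show "Lam (n - 1) a i \<le> Suc (Lam n a i)"
    using Mu_Suc[of "n - 1" a i] Mu_le[of n a i] n by simp
  show "Lam n a (Suc i) \<le> Lam (n - 1) a i" if "1 \<le> i"
    using Mu_Suc[of "n - 1" a i] Lam_le[of i n a] that n by simp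
qed (use n Lam_ptuple Lam_rows in auto)

end

lemma finite_llt_sequences: "finite {(Lam, Mu). llt_sequences k N Lam Mu}"
proof -
  let ?F = "(\<lambda>f n a i. f (n, a, i)) ` PiE_dflt ({..N} \<times> {..k} \<times> {..N}) 0 (\<lambda>_. {..N})"
  have F: "A \<in> ?F" if "\<And>n a i. A n a i \<le> N" "\<And>n a i. A n a i \<noteq> 0 \<Longrightarrow> n \<le> N \<and> a \<le> k \<and> i \<le> N"
    for A :: "nat \<Rightarrow> ptuple"
    using that by (intro rev_image_eqI[of "\<lambda>(n, a, i). A n a i"]) (force simp: PiE_dflt_def)+
  have "Lam \<in> ?F \<and> Mu \<in> ?F" if "llt_sequences k N Lam Mu" for Lam Mu
  proof -
    interpret llt_sequences k N Lam Mu by (rule that)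
    have "Mu n a i \<le> N" for n a i
      using Mu_le Lam_bound le_trans by blast
    moreover have "n \<le> N \<and> a \<le> k \<and> i \<le> N" if "Mu n a i \<noteq> 0" for n a i
      using that Mu_le[of n a i] by (intro Lam_support) auto
    ultimately show ?thesis
      using Lam_bound Lam_support by (intro conjI F) auto
  qed
  then have "{(Lam, Mu). llt_sequences k N Lam Mu} \<subseteq> ?F \<times> ?F"
    by auto
  moreover have "finite ?F"
    by (intro finite_imageI finite_PiE_dflt) auto
  ultimately show ?thesis
    by (meson finite_SigmaI finite_subset)
qed

text \<open>
  Finiteness of the support makes the normalization of the weight meaningful; that some state has
  positive weight is witnessed by the empty one.
\<close>

lemma llt_process_support:
  assumes c: "\<And>n. n \<in> {1..N} \<Longrightarrow> c n > 0" and b: "\<And>n. n \<in> {1..N} \<Longrightarrow> b n > 0" and t: "t > 0"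
    and supp: "(Lam, Mu) \<in> set_pmf (llt_process k N c b t)"
  shows "llt_sequences k N Lam Mu"
proof -
  let ?w = "llt_weight k N c b t" and ?A = "llt_states k N"
  have b': "b (Suc N - n) > 0" if "n \<in> {1..N}" for n
    using that by (intro b) auto
  have nonneg: "0 \<le> ?w x" if "x \<in> ?A" for x
    unfolding llt_weight_def using c b' t
    by (auto simp: case_prod_unfold intro!: prod_nonneg mult_nonneg_nonneg LLT_nonneg dual_LLT_nonneg)
  have "{x \<in> ?A. ?w x \<noteq> 0} \<subseteq> {(Lam, Mu). llt_sequences k N Lam Mu}"
    using llt_sequences_if_weight by auto
  then have fin: "finite {x \<in> ?A. ?w x \<noteq> 0}"
    using finite_llt_sequences finite_subset by blast
  let ?e = "\<lambda>_::nat. empty_ptuple"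
  have "?w (?e, ?e) > 0"
    unfolding llt_weight_def using c b' t
    by (auto intro!: prod_pos mult_pos_pos LLT_pos empty_ptuple_in_ptuples
        simp: dual_LLT_def cointerlace_def)
  moreover have "(?e, ?e) \<in> ?A"
    by (auto simp: llt_states_def empty_ptuple_in_ptuples)
  ultimately have "{x \<in> ?A. ?w x \<noteq> 0} \<noteq> {}"
    by force
  from pmf_normalized_pmf[of ?A ?w, OF nonneg fin this] supp
  have "(Lam, Mu) \<in> ?A" "?w (Lam, Mu) \<noteq> 0"
    by (auto simp: llt_process_def set_pmf_iff split: if_splits)
  then show ?thesis by (rule llt_sequences_if_weight)
qed


section \<open>Particle dynamics\<close>

lemma inj_particle_position: "inj (\<lambda>v. real v - real i + 1 / 2)"
  by (rule injI) simp

lemma position_le_iff: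
  "real p - real j + 1 / 2 \<le> real q - real i + 1 / 2 \<longleftrightarrow> int p - int j \<le> int q - int i"
  "real p - real j + 1 / 2 \<le> real q - real i + 1 / 2 + 1 \<longleftrightarrow> int p - int j \<le> int q - int i + 1"
  "real q - real i + 1 / 2 + 1 \<le> real p - real j + 1 / 2 \<longleftrightarrow> int q - int i + 1 \<le> int p - int j"
proof -
  have "real p - real j + 1 / 2 \<le> real q - real i + 1 / 2 \<longleftrightarrow>
      real_of_int (int p - int j) \<le> real_of_int (int q - int i)"
    "real p - real j + 1 / 2 \<le> real q - real i + 1 / 2 + 1 \<longleftrightarrow>
      real_of_int (int p - int j) \<le> real_of_int (int q - int i + 1)"
    "real q - real i + 1 / 2 + 1 \<le> real p - real j + 1 / 2 \<longleftrightarrow>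
      real_of_int (int q - int i + 1) \<le> real_of_int (int p - int j)"
    by auto
  then show
    "real p - real j + 1 / 2 \<le> real q - real i + 1 / 2 \<longleftrightarrow> int p - int j \<le> int q - int i"
    "real p - real j + 1 / 2 \<le> real q - real i + 1 / 2 + 1 \<longleftrightarrow> int p - int j \<le> int q - int i + 1"
    "real q - real i + 1 / 2 + 1 \<le> real p - real j + 1 / 2 \<longleftrightarrow> int q - int i + 1 \<le> int p - int j"
    by (simp_all only: of_int_le_iff)
qed

lemma (in level_configuration) jump_eq_row_step:
  assumes p: "(l, i) \<in> rows"
    and x: "\<And>m j. (m, j) \<in> rows \<Longrightarrow> x (n, m, j) = real (L m j) - real j + 1 / 2"
    and y: "\<And>m j. (m, j) \<in> rows \<Longrightarrow> extended_y y (n, m, j) = real (M m j) - real j + 1 / 2"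
  shows "jump k N c b t x y (n, l, i) =
    map_pmf (\<lambda>v. real v - real i + 1 / 2) (row_step (\<lambda>l i. c n * b (N + 2 - n) * t ^ blocks l i) (l, i))"
proof -
  have li: "l \<in> {1..k}" "i \<in> {1..n}" using p by (auto simp: rows_def)
  have count: "block_count k x y (n, l, i) = blocks l i"
    unfolding block_count_def blocks_def prod.case x[OF p]
    by (intro arg_cong2[of _ _ _ _ "(+)"] arg_cong[of _ _ card] Collect_cong conj_cong refl bex_cong)
      (simp_all only: x y rows_def mem_Times_iff fst_conv snd_conv simp_thms position_le_iff)
  have up: "x (n, l, i) = extended_y y (n, l, i) - 1 \<longleftrightarrow> Suc (L l i) = M l i"
    using x[OF p] y[OF p] by auto
  have stay: "x (n, l, i) = extended_y y (n, l, i - 1) - 1 \<longleftrightarrow> L l i = M l (i - 1)" if "2 \<le> i"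
  proof -
    have "(l, i - 1) \<in> rows" "real (i - 1) = real i - 1"
      using li that by (auto simp: rows_def)
    then show ?thesis using x[OF p] y[of l "i - 1"] by auto
  qed
  have xp: "x (n, l, i) + 1 = real (Suc (L l i)) - real i + 1 / 2"
    using x[OF p] by simp
  show ?thesis
  proof (cases "Suc (L l i) = M l i")
    case True
    then show ?thesis
      unfolding jump_def row_step_def prod.case up by (simp only: if_True simp_thms map_return_pmf xp)
  next
    case notup: False
    show ?thesis
    proof (cases "2 \<le> i \<and> L l i = M l (i - 1)")
      case True
      then show ?thesis
        using notup stay unfolding jump_def row_step_def prod.case up by (simp add: x[OF p])
    next
      case False
      then have "\<not> (2 \<le> i \<and> x (n, l, i) = extended_y y (n, l, i - 1) - 1)"
        using stay by blast
      then show ?thesis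
        using notup False unfolding jump_def row_step_def prod.case up count Let_def
        by (simp only: if_False x[OF p] pmf.map_comp o_def) (rule map_pmf_cong[OF refl], simp)
    qed
  qed
qed

text \<open>
  Positions determine the tuples on the support of the update, so it suffices to compare
  probability mass functions there. Both are products of the transition probabilities of all rows,
  once grouped by levels and once not.
\<close>

lemma (in llt_sequences) update_eq_particles:
  assumes c: "\<And>n. n \<in> {1..N+1} \<Longrightarrow> c n > 0" and b: "\<And>n. n \<in> {1..N+1} \<Longrightarrow> b n > 0" and t: "t > 0"
  shows "map_pmf (particle_positions k N) (llt_update k N c b t (Lam, Mu)) =
         particle_update k N c b t (particle_positions k N (Lam, Mu))"
proof -
  define M where "M = (\<lambda>n. if n \<in> {2..N+1} then Lam (n - 1) else empty_ptuple)"
  define X :: "(nat \<Rightarrow> ptuple) \<Rightarrow> positions" where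
    "X = (\<lambda>A (n, l, i). if (n, l, i) \<in> x_indices k N then real (A n l i) - real i + 1 / 2 else 0)"
  define y where "y = (\<lambda>(n, l, i). if (n, l, i) \<in> y_indices k N then X Lam (n - 1, l, i) else 0)"
  define q where "q = (\<lambda>n l i. c n * b (N + 2 - n) * t ^ level_configuration.blocks k n (Lam n) (M n) l i)"
  define R where "R = (\<lambda>n::nat. {1::nat..k} \<times> {1..n})"
  define rs where "rs = (\<lambda>n. level_configuration.row_step (Lam n) (M n) (q n))"
  define P where "P = Pi_pmf {1..N+1} empty_ptuple (\<lambda>n. P_tilde k n c (b (N + 2 - n)) t (Lam n) (M n))"
  \<comment> \<open>at \<open>n = 1\<close> this uses that the tuple of level 0 is empty\<close>
  have M: "M n = Lam (n - 1)" if "n \<in> {1..N+1}" for n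
    using that Lam_outside[of 0] by (cases "n = 1") (auto simp: M_def)
  have conf: "level_configuration k n (Lam n) (M n)" if "n \<in> {1..N+1}" for n
    using level_configuration[of n] that by (simp add: M)
  have idx: "x_indices k N = (SIGMA n:{1..N+1}. R n)"
    by (auto simp: x_indices_def R_def)
  have Y: "(\<lambda>(n, l, i). if (n, l, i) \<in> y_indices k N then real (M n l i) - real i + 1 / 2 else 0) = y"
    unfolding y_def X_def
    by (intro ext) (auto simp: M_def y_indices_def x_indices_def)
  \<comment> \<open>the conventional particle \<open>j = n\<close> sits where an empty row \<open>n\<close> of \<open>M n\<close> puts it\<close>
  have ext_y: "extended_y y (n, m, j) = real (M n m j) - real j + 1 / 2"
    if "n \<in> {1..N+1}" "(m, j) \<in> R n" for n m j
  proof (cases "j = n")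
    case True
    then show ?thesis
      using that Lam_rows[of "n - 1" n m] by (simp add: extended_y_def M)
  next
    case False
    then have "(n, m, j) \<in> y_indices k N" "(n - 1, m, j) \<in> x_indices k N"
      using that by (auto simp: R_def y_indices_def x_indices_def)
    then show ?thesis
      using that False by (simp add: extended_y_def y_def X_def M)
  qed
  have jump: "jump k N c b t (X Lam) y (n, l, i) = map_pmf (\<lambda>v. real v - real i + 1 / 2) (rs n (l, i))"
    if "n \<in> {1..N+1}" "(l, i) \<in> R n" for n l i
  proof -
    interpret lc: level_configuration k n "Lam n" "M n" by (rule conf[OF that(1)])
    have rows: "lc.rows = R n" by (simp add: R_def lc.rows_def)
    show ?thesis
      unfolding rs_def q_def using that
      by (intro lc.jump_eq_row_step) (auto simp: rows ext_y idx X_def)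
  qed
  have level: "(\<forall>l i. (l, i) \<notin> R n \<longrightarrow> K l i = 0) \<and>
       pmf (P_tilde k n c (b (N + 2 - n)) t (Lam n) (M n)) K = (\<Prod>(l, i)\<in>R n. pmf (rs n (l, i)) (K l i))"
    if n: "n \<in> {1..N+1}" and K: "K \<in> set_pmf (P_tilde k n c (b (N + 2 - n)) t (Lam n) (M n))" for n K
  proof -
    interpret lc: level_configuration k n "Lam n" "M n" by (rule conf[OF n])
    have rows: "lc.rows = R n" by (simp add: R_def lc.rows_def)
    have step: "P_tilde k n c (b (N + 2 - n)) t (Lam n) (M n) = lc.step (q n)"
      unfolding q_def using n by (intro lc.P_tilde_eq_step c b t) auto
    show ?thesis
      using K unfolding step set_pmf_iff lc.pmf_step rows rs_def
      by (auto split: if_splits) (metis less_irrefl)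
  qed
  have supp: "A n = empty_ptuple" if "A \<in> set_pmf P" "n \<notin> {1..N+1}" for A n
    using that set_Pi_pmf_subset[of "{1..N+1}"] unfolding P_def by fastforce
  have supp': "A n \<in> set_pmf (P_tilde k n c (b (N + 2 - n)) t (Lam n) (M n))"
    if "A \<in> set_pmf P" "n \<in> {1..N+1}" for A n
    using that unfolding P_def set_Pi_pmf[OF finite_atLeastAtMost] PiE_dflt_def by auto
  have inj: "inj_on X (set_pmf P)"
  proof (rule inj_onI, intro ext)
    fix A B n l i assume A: "A \<in> set_pmf P" and B: "B \<in> set_pmf P" and "X A = X B"
    show "A n l i = B n l i"
    proof (cases "n \<in> {1..N+1} \<and> (l, i) \<in> R n")
      case True
      with fun_cong[OF \<open>X A = X B\<close>, of "(n, l, i)"] show ?thesis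
        by (auto simp: X_def idx)
    next
      case False
      then show ?thesis
        using supp[OF A, of n] supp[OF B, of n] level[OF _ supp'[OF A]] level[OF _ supp'[OF B]]
        by (cases "n \<in> {1..N+1}") auto
    qed
  qed
  have "map_pmf X P = Pi_pmf (x_indices k N) 0 (jump k N c b t (X Lam) y)"
  proof (rule pmf_eq_on_support)
    fix f assume "f \<in> set_pmf (map_pmf X P)"
    then obtain A where A: "A \<in> set_pmf P" and f: "f = X A" by auto
    have "pmf (map_pmf X P) f = pmf P A"
      unfolding f by (rule pmf_map_inj[OF inj A])
    also have "\<dots> = (\<Prod>n\<in>{1..N+1}. pmf (P_tilde k n c (b (N + 2 - n)) t (Lam n) (M n)) (A n))"
      unfolding P_def by (rule pmf_Pi') (use supp[OF A] in auto)
    also have "\<dots> = (\<Prod>n\<in>{1..N+1}. \<Prod>(l, i)\<in>R n. pmf (rs n (l, i)) (A n l i))"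
      by (intro prod.cong refl) (use level supp'[OF A] in blast)
    also have "\<dots> = (\<Prod>(n, l, i)\<in>x_indices k N. pmf (rs n (l, i)) (A n l i))"
      unfolding idx by (subst prod.Sigma) (auto simp: R_def case_prod_unfold)
    also have "\<dots> = (\<Prod>p\<in>x_indices k N. pmf (jump k N c b t (X Lam) y p) (f p))"
    proof (rule prod.cong[OF refl], clarify)
      fix n l i assume p: "(n, l, i) \<in> x_indices k N"
      then have "n \<in> {1..N+1}" "(l, i) \<in> R n" by (auto simp: idx)
      moreover have "f (n, l, i) = real (A n l i) - real i + 1 / 2"
        using p by (simp add: f X_def)
      ultimately have "pmf (jump k N c b t (X Lam) y (n, l, i)) (f (n, l, i)) =
          pmf (map_pmf (\<lambda>v. real v - real i + 1 / 2) (rs n (l, i))) (real (A n l i) - real i + 1 / 2)"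
        by (simp add: jump)
      then show "pmf (rs n (l, i)) (A n l i) = pmf (jump k N c b t (X Lam) y (n, l, i)) (f (n, l, i))"
        by (simp only: pmf_map_inj'[OF inj_particle_position])
    qed
    also have "\<dots> = pmf (Pi_pmf (x_indices k N) 0 (jump k N c b t (X Lam) y)) f"
      by (rule pmf_Pi'[symmetric]) (auto simp: f X_def idx R_def split: if_splits)
    finally show "pmf (map_pmf X P) f = pmf (Pi_pmf (x_indices k N) 0 (jump k N c b t (X Lam) y)) f" .
  qed
  moreover have "particle_positions k N (A, M) = (X A, y)" for A
    unfolding particle_positions_def prod.case Y X_def by simp
  moreover have "particle_update k N c b t (particle_positions k N (Lam, Mu)) =
      map_pmf (\<lambda>x. (x, y)) (Pi_pmf (x_indices k N) 0 (jump k N c b t (X Lam) y))"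
    unfolding particle_update_def particle_positions_def prod.case y_def X_def Let_def ..
  moreover have "llt_update k N c b t (Lam, Mu) = map_pmf (\<lambda>A. (A, M)) P"
    by (simp add: llt_update_def Let_def M_def P_def)
  ultimately show ?thesis
    by (simp add: pmf.map_comp o_def flip: \<open>map_pmf X P = _\<close>)
qed

theorem proposition3p9:
  fixes k N :: nat and c b :: "nat \<Rightarrow> real" and t :: real and Lam Mu :: "nat \<Rightarrow> ptuple"
  assumes "k \<ge> 1" and "N \<ge> 1"
    and "\<And>n. n \<in> {1..N+1} \<Longrightarrow> c n > 0"
    and "\<And>n. n \<in> {1..N+1} \<Longrightarrow> b n > 0"
    and "t > 0"
    and "(Lam, Mu) \<in> set_pmf (llt_process k N c b t)"
  shows "map_pmf (particle_positions k N) (llt_update k N c b t (Lam, Mu)) =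
         particle_update k N c b t (particle_positions k N (Lam, Mu))"
proof -
  interpret llt_sequences k N Lam Mu
    using assms by (intro llt_process_support) auto
  show ?thesis
    using assms by (intro update_eq_particles) auto
qed

end
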